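(* Let $f_1,\dots,f_n:\mathbb{R}^d\to\mathbb{R}$ be convex and differentiable, with $\nabla f_i$ being $L_i$-Lipschitz ($L_i>0$) in the Euclidean norm, let $R:\mathbb{R}^d\to\mathbb{R}$ be $\mu$-strongly convex with $\mu\ge0$ ($\mu=0$, i.e. $R$ merely convex, is allowed), and suppose that $P=\frac1n\sum_{i=1}^n f_i+R$ has a minimizer $x_*$. Let $\widetilde x_0\in\mathbb{R}^d$, $\eta=4\bar L$ where $\bar L=\frac1n\sum_{i=1}^n L_i$, $m_1,S\in\mathbb{N}$ positive, and $\alpha=0$. Then the iterates of the SVRDA algorithm for non-strongly convex regularizers (defined in the context, with $m_s=2^{s-1}m_1$) satisfy $$\mathbb{E}[P(\widetilde x_S)-P(x_* )]\le\frac1{2^S}\Big[P(\widetilde x_0)-P(x_* )+\frac{4\bar L}{m_1}\|\widetilde x_0-x_*\|^2\Big].$$ In addition, if $m_1=O(\bar L)$, then SVRDA has gradient complexity (defined in the context) $O\big(n\log\frac1\varepsilon+\frac{\bar L}{\varepsilon}\big)$ for $\mathbb{E}[P(\widetilde x_S)-P(x_* )]\le\varepsilon$. That is, if $m_1\le c\bar L$, then, with $D=P(\widetilde x_0)-P(x_* )+\frac{4\bar L}{m_1}\|\widetilde x_0-x_*\|^2$, there is a constant $C$ depending only on $c$ and $D$ such that for every $\varepsilon\in(0,\frac12]$ there is $S\ge1$ for which $\mathbb{E}[P(\widetilde x_S)-P(x_* )]\le\varepsilon$ and the number of component gradient evaluations used in the first $S$ stages is at most $C\big(n\log\frac1\varepsilon+\frac{\bar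 L}{\varepsilon}\big)$.
   Context: All norms are Euclidean. $F=\frac1n\sum_{i=1}^n f_i$ and $P=F+R$. $R$ is $\mu$-strongly convex ($\mu\ge0$) means $R(y)\ge R(x)+\xi^\top(y-x)+\frac{\mu}{2}\|y-x\|^2$ for all $x,y\in\mathbb{R}^d$ and all $\xi\in\partial R(x)$. $Q$ is the probability distribution on $\{1,\dots,n\}$ with weights $q_i=L_i/(n\bar L)$. SVRDA algorithm (non-strongly convex version) with inputs $\widetilde x_0\in\mathbb{R}^d$, $\eta>0$, $m_1$, and $\alpha$: set $\widetilde v_0=\widetilde x_0$. For stages $s=1,2,\dots$: put $x_0=\widetilde x_{s-1}$, $v_0=(1-\alpha)\widetilde v_{s-1}+\alpha\widetilde x_{s-1}$ (so $v_0=\widetilde v_{s-1}$ when $\alpha=0$), $u_0=v_0$, $\bar g_0=0$, and $m_s=2^{s-1}m_1$. For $t=1,\dots,m_s$: draw $i_t$ from $Q$ independently of all earlier draws (in this and previous stages) and set $$g_t=\frac{\nabla f_{i_t}(u_{t-1})-\nabla f_{i_t}(x_0)}{nq_{i_t}}+\nabla F(x_0),\qquad \bar g_t=\Big(1-\frac1t\Big)\bar g_{t-1}+\frac1t g_t,$$ $$v_t=\operatorname*{argmin}_{x\in\mathbb{R}^d}\Big\{\langle\bar g_t,x\rangle+R(x)+\frac{\eta}{2t}\|x-v_0\|^2\Big\},\qquad x_t=\operatorname*{argmin}_{x\in\mathbb{R}^d}\Big\{\langle g_t,x\rangle+R(x)+\frac{\eta t}{2}\|x-u_{t-1}\|^2\Big\},$$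 $$u_t=\Big(1-\frac1{t+1}\Big)x_t+\frac1{t+1}v_t .$$ Finally put $\widetilde x_s=x_{m_s}$ and $\widetilde v_s=v_{m_s}$. The expectation $\mathbb{E}$ is over all random draws. Gradient complexity is the order of the number of evaluations of component gradients $\nabla f_i$ needed to reach the stated accuracy; stage $s$ costs $n$ evaluations for $\nabla F(x_0)$ plus $2$ per inner iteration, i.e. $n+2m_s$, so $S$ stages cost $\sum_{s=1}^S(n+2m_s)$. *)

theory Defs
  imports "HOL-Analysis.Analysis" "HOL-Probability.Probability_Mass_Function"
begin

text \<open>
  The constant in the complexity bound must not depend on the dimension, so the dimension has to be
  quantified inside the statement and cannot be a type. We therefore realise every
  \<open>\<real>\<^sup>d\<close> as a subspace \<open>Rn d\<close> of one inner product space, the finitely supported real sequences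
  with the usual inner product. On \<open>Rn d\<close> its norm is the Euclidean norm (\<open>norm_Rn\<close>).
\<close>

typedef fin_seq = "{x :: nat \<Rightarrow> real. finite {i. x i \<noteq> 0}}"
  morphisms coord Fin_Seq
  by (rule exI[of _ "\<lambda>_. 0"]) simp

setup_lifting type_definition_fin_seq

lemma finite_coord: "finite {i. coord x i \<noteq> 0}"
  using coord[of x] by simp

lemma fin_seq_eqI: "(\<And>i. coord x i = coord y i) \<Longrightarrow> x = y"
  by (metis coord_inject ext)

instantiation fin_seq :: real_vector
begin

lift_definition zero_fin_seq :: fin_seq is "\<lambda>_. 0" by simp

lift_definition plus_fin_seq :: "fin_seq \<Rightarrow> fin_seq \<Rightarrow> fin_seq" is "\<lambda>x y i. x i + y i"
  subgoal for x y by (rule finite_subset[of _ "{i. x i \<noteq> 0} \<union> {i. y i \<noteq> 0}"]) auto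
  done

lift_definition uminus_fin_seq :: "fin_seq \<Rightarrow> fin_seq" is "\<lambda>x i. - x i" by simp

lift_definition minus_fin_seq :: "fin_seq \<Rightarrow> fin_seq \<Rightarrow> fin_seq" is "\<lambda>x y i. x i - y i"
  subgoal for x y by (rule finite_subset[of _ "{i. x i \<noteq> 0} \<union> {i. y i \<noteq> 0}"]) auto
  done

lift_definition scaleR_fin_seq :: "real \<Rightarrow> fin_seq \<Rightarrow> fin_seq" is "\<lambda>c x i. c * x i"
  by (erule rev_finite_subset) auto

instance
  by standard (transfer; force simp: algebra_simps)+

end

lemmas coord_simps [simp] =
  zero_fin_seq.rep_eq plus_fin_seq.rep_eq uminus_fin_seq.rep_eq minus_fin_seq.rep_eq
  scaleR_fin_seq.rep_eq

definition fin_seq_inner :: "fin_seq \<Rightarrow> fin_seq \<Rightarrow> real" where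
  "fin_seq_inner x y = (\<Sum>i | coord x i \<noteq> 0. coord x i * coord y i)"

lemma fin_seq_inner_eq:
  assumes "finite A" "{i. coord x i \<noteq> 0} \<subseteq> A"
  shows "fin_seq_inner x y = (\<Sum>i\<in>A. coord x i * coord y i)"
  unfolding fin_seq_inner_def by (rule sum.mono_neutral_left) (use assms in auto)

instantiation fin_seq :: real_inner
begin

definition inner_fin_seq :: "fin_seq \<Rightarrow> fin_seq \<Rightarrow> real" where
  "inner_fin_seq = fin_seq_inner"

definition norm_fin_seq :: "fin_seq \<Rightarrow> real" where
  "norm_fin_seq x = sqrt (inner x x)"

definition sgn_fin_seq :: "fin_seq \<Rightarrow> fin_seq" where
  "sgn_fin_seq x = x /\<^sub>R norm x"

definition dist_fin_seq :: "fin_seq \<Rightarrow> fin_seq \<Rightarrow> real" where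
  "dist_fin_seq x y = norm (x - y)"

definition uniformity_fin_seq :: "(fin_seq \<times> fin_seq) filter" where
  "uniformity_fin_seq = (INF e\<in>{0<..}. principal {(x, y). dist x y < e})"

definition open_fin_seq :: "fin_seq set \<Rightarrow> bool" where
  "open_fin_seq U = (\<forall>x\<in>U. eventually (\<lambda>(x', y). x' = x \<longrightarrow> y \<in> U) uniformity)"

instance
proof
  fix x y z :: fin_seq and r :: real
  let ?A = "{i. coord x i \<noteq> 0} \<union> {i. coord y i \<noteq> 0} \<union> {i. coord z i \<noteq> 0}"
  have A: "finite ?A" by (simp add: finite_coord)
  have eq: "inner a b = (\<Sum>i\<in>?A. coord a i * coord b i)"
    if "\<And>i. coord x i = 0 \<Longrightarrow> coord y i = 0 \<Longrightarrow> coord z i = 0 \<Longrightarrow> coord a i = 0" for a b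
    unfolding inner_fin_seq_def by (rule fin_seq_inner_eq[OF A]) (use that in blast)
  show "dist x y = norm (x - y)" by (rule dist_fin_seq_def)
  show "sgn x = x /\<^sub>R norm x" by (rule sgn_fin_seq_def)
  show "(uniformity :: (fin_seq \<times> fin_seq) filter) =
      (INF e\<in>{0<..}. principal {(x, y). dist x y < e})"
    by (rule uniformity_fin_seq_def)
  show "open U = (\<forall>x\<in>U. eventually (\<lambda>(x', y). x' = x \<longrightarrow> y \<in> U) uniformity)" for U :: "fin_seq set"
    by (rule open_fin_seq_def)
  show "inner x y = inner y x"
    by (simp add: eq mult.commute)
  show "inner (x + y) z = inner x z + inner y z"
    by (simp add: eq algebra_simps sum.distrib)
  show "inner (r *\<^sub>R x) y = r * inner x y"
    by (simp add: eq algebra_simps sum_distrib_left)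
  show "0 \<le> inner x x"
    by (simp add: eq sum_nonneg)
  have "inner x x = (\<Sum>i\<in>?A. coord x i * coord x i)" by (rule eq) simp
  also have "\<dots> = 0 \<longleftrightarrow> (\<forall>i\<in>?A. coord x i * coord x i = 0)"
    by (rule sum_nonneg_eq_0_iff[OF A]) simp
  also have "\<dots> \<longleftrightarrow> (\<forall>i. coord x i = 0)" by auto
  also have "\<dots> \<longleftrightarrow> x = 0" by (metis fin_seq_eqI zero_fin_seq.rep_eq)
  finally show "inner x x = 0 \<longleftrightarrow> x = 0" .
  show "norm x = sqrt (inner x x)" by (rule norm_fin_seq_def)
qed

end

definition Rn :: "nat \<Rightarrow> fin_seq set" where
  "Rn d = {x. \<forall>i\<ge>d. coord x i = 0}"

lemma inner_Rn: "x \<in> Rn d \<Longrightarrow> inner x y = (\<Sum>i<d. coord x i * coord y i)"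
  unfolding inner_fin_seq_def Rn_def
  by (rule fin_seq_inner_eq) (auto simp: not_le[symmetric])

lemma norm_Rn: "x \<in> Rn d \<Longrightarrow> norm x = L2_set (coord x) {..<d}"
  by (simp add: norm_fin_seq_def inner_Rn L2_set_def power2_eq_square)

lemma subspace_Rn: "subspace (Rn d)"
  by (auto simp: subspace_def Rn_def)

lemma bij_betw_coord_Rn: "bij_betw coord (Rn d) {x. \<forall>i\<ge>d. x i = 0}"
proof (rule bij_betwI[where g = Fin_Seq])
  have inv: "coord (Fin_Seq x) = x" if x: "\<forall>i\<ge>d. x i = 0" for x
  proof (rule Fin_Seq_inverse)
    have "{i. x i \<noteq> 0} \<subseteq> {..<d}" using x by (metis (mono_tags) lessThan_iff mem_Collect_eq not_le subsetI)
    then show "x \<in> {x. finite {i. x i \<noteq> 0}}" by (simp add: finite_subset)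
  qed
  show "coord \<in> Rn d \<rightarrow> {x. \<forall>i\<ge>d. x i = 0}" by (auto simp: Rn_def)
  show "Fin_Seq \<in> {x. \<forall>i\<ge>d. x i = 0} \<rightarrow> Rn d" by (auto simp: Rn_def inv)
  show "Fin_Seq (coord x) = x" for x by (rule coord_inverse)
  show "coord (Fin_Seq x) = x" if "x \<in> {x. \<forall>i\<ge>d. x i = 0}" for x using that inv by simp
qed


text \<open>
  Below, \<open>E\<close> is the space \<open>\<real>\<^sup>d\<close> in question, i.e. \<open>Rn d\<close>. Functions on \<open>E\<close> are total functions of
  which only the values on \<open>E\<close> are used.
\<close>

definition grad :: "'a::real_inner set \<Rightarrow> ('a \<Rightarrow> real) \<Rightarrow> 'a \<Rightarrow> 'a" where
  "grad E h x = (THE g. g \<in> E \<and> (h has_derivative (\<lambda>y. inner g y)) (at x within E))"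

definition subdiff :: "'a::real_inner set \<Rightarrow> ('a \<Rightarrow> real) \<Rightarrow> 'a \<Rightarrow> 'a set" where
  "subdiff E h x = {\<xi> \<in> E. \<forall>y\<in>E. h y \<ge> h x + inner \<xi> (y - x)}"

text \<open>
  Convexity is a separate conjunct because the subgradient inequality alone holds vacuously where
  the subdifferential is empty.
\<close>

definition strongly_convex :: "'a::real_inner set \<Rightarrow> real \<Rightarrow> ('a \<Rightarrow> real) \<Rightarrow> bool" where
  "strongly_convex E \<mu> h \<longleftrightarrow> convex_on E h \<and>
     (\<forall>x\<in>E. \<forall>y\<in>E. \<forall>\<xi>\<in>subdiff E h x.
        h y \<ge> h x + inner \<xi> (y - x) + \<mu> / 2 * (norm (y - x))\<^sup>2)"

definition avg_L :: "nat \<Rightarrow> (nat \<Rightarrow> real) \<Rightarrow> real" where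
  "avg_L n L = (1 / real n) * (\<Sum>i=1..n. L i)"

definition avg_fun :: "nat \<Rightarrow> (nat \<Rightarrow> 'a \<Rightarrow> real) \<Rightarrow> 'a \<Rightarrow> real" where
  "avg_fun n f x = (1 / real n) * (\<Sum>i=1..n. f i x)"

definition objective :: "nat \<Rightarrow> (nat \<Rightarrow> 'a \<Rightarrow> real) \<Rightarrow> ('a \<Rightarrow> real) \<Rightarrow> 'a \<Rightarrow> real" where
  "objective n f R x = avg_fun n f x + R x"

definition problem ::
  "'a::real_inner set \<Rightarrow> nat \<Rightarrow> (nat \<Rightarrow> 'a \<Rightarrow> real) \<Rightarrow> (nat \<Rightarrow> real) \<Rightarrow> ('a \<Rightarrow> real) \<Rightarrow> real \<Rightarrow> 'a \<Rightarrow> bool"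
where
  "problem E n f L R \<mu> xs \<longleftrightarrow>
     n \<ge> 1 \<and>
     (\<forall>i\<in>{1..n}. convex_on E (f i) \<and> f i differentiable_on E \<and>
        L i > 0 \<and> (L i)-lipschitz_on E (grad E (f i))) \<and>
     \<mu> \<ge> 0 \<and> strongly_convex E \<mu> R \<and>
     is_arg_min (objective n f R) (\<lambda>x. x \<in> E) xs"

definition weight :: "nat \<Rightarrow> (nat \<Rightarrow> real) \<Rightarrow> nat \<Rightarrow> real" where
  "weight n L i = L i / (real n * avg_L n L)"

text \<open>
  \<open>embed_pmf\<close> is meaningful only for nonnegative weights summing to one; for positive
  \<open>L i\<close> and \<open>n \<ge> 1\<close> this is \<open>pmf_Q\<close>.
\<close>

definition Q :: "nat \<Rightarrow> (nat \<Rightarrow> real) \<Rightarrow> nat pmf" where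
  "Q n L = embed_pmf (\<lambda>i. if i \<in> {1..n} then weight n L i else 0)"

lemma pmf_Q:
  assumes "n \<ge> 1" "\<And>i. i \<in> {1..n} \<Longrightarrow> L i > 0"
  shows "pmf (Q n L) i = (if i \<in> {1..n} then weight n L i else 0)"
  unfolding Q_def
proof (rule pmf_embed_pmf)
  have pos: "(\<Sum>i=1..n. L i) > 0" using assms by (intro sum_pos) auto
  have w: "weight n L i = L i / (\<Sum>i=1..n. L i)" for i
    using assms(1) by (simp add: weight_def avg_L_def)
  have nn: "i \<in> {1..n} \<Longrightarrow> 0 \<le> weight n L i" for i
    using pos assms(2) by (auto simp: w less_imp_le)
  then show "0 \<le> (if i \<in> {1..n} then weight n L i else 0)" for i by auto
  have "(\<integral>\<^sup>+i. ennreal (if i \<in> {1..n} then weight n L i else 0) \<partial>count_space UNIV)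
      = (\<Sum>i=1..n. ennreal (weight n L i))"
    by (subst nn_integral_count_space'[where A = "{1..n}"]) auto
  also have "\<dots> = ennreal (\<Sum>i=1..n. weight n L i)"
    using nn by (intro sum_ennreal) auto
  also have "(\<Sum>i=1..n. weight n L i) = 1"
    using pos by (simp add: w flip: sum_divide_distrib)
  finally show "(\<integral>\<^sup>+i. ennreal (if i \<in> {1..n} then weight n L i else 0) \<partial>count_space UNIV) = 1"
    by simp
qed

text \<open>
  Inner iteration number \<open>t \<ge> 1\<close> with drawn index \<open>i\<close>, on states \<open>(gbar, x, v, u)\<close>. For convex
  \<open>R\<close> and \<open>\<eta> > 0\<close> both minimisation problems are strongly convex, so the choice made by
  \<open>arg_min_on\<close> is the unique minimiser.
\<close>

fun svrda_step ::
  "'a::real_inner set \<Rightarrow> nat \<Rightarrow> (nat \<Rightarrow> 'a \<Rightarrow> real) \<Rightarrow> (nat \<Rightarrow> real) \<Rightarrow> ('a \<Rightarrow> real) \<Rightarrow> real \<Rightarrow>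
   'a \<Rightarrow> 'a \<Rightarrow> nat \<Rightarrow> nat \<Rightarrow> 'a \<times> 'a \<times> 'a \<times> 'a \<Rightarrow> 'a \<times> 'a \<times> 'a \<times> 'a"
where
  "svrda_step E n f L R \<eta> x0 v0 t i (gbar, x, v, u) =
     (let g = (grad E (f i) u - grad E (f i) x0) /\<^sub>R (real n * weight n L i)
              + grad E (avg_fun n f) x0;
          gbar' = (1 - 1 / real t) *\<^sub>R gbar + (1 / real t) *\<^sub>R g;
          v' = arg_min_on (\<lambda>z. inner gbar' z + R z + \<eta> / (2 * real t) * (norm (z - v0))\<^sup>2) E;
          x' = arg_min_on (\<lambda>z. inner g z + R z + \<eta> * real t / 2 * (norm (z - u))\<^sup>2) E;
          u' = (1 - 1 / (real t + 1)) *\<^sub>R x' + (1 / (real t + 1)) *\<^sub>R v'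
      in (gbar', x', v', u'))"

primrec svrda_inner ::
  "'a::real_inner set \<Rightarrow> nat \<Rightarrow> (nat \<Rightarrow> 'a \<Rightarrow> real) \<Rightarrow> (nat \<Rightarrow> real) \<Rightarrow> ('a \<Rightarrow> real) \<Rightarrow> real \<Rightarrow>
   'a \<Rightarrow> 'a \<Rightarrow> nat \<Rightarrow> ('a \<times> 'a \<times> 'a \<times> 'a) pmf"
where
  "svrda_inner E n f L R \<eta> x0 v0 0 = return_pmf (0, x0, v0, v0)"
| "svrda_inner E n f L R \<eta> x0 v0 (Suc t) =
     do { st \<leftarrow> svrda_inner E n f L R \<eta> x0 v0 t;
          i \<leftarrow> Q n L;
          return_pmf (svrda_step E n f L R \<eta> x0 v0 (Suc t) i st) }"

definition stage_length :: "nat \<Rightarrow> nat \<Rightarrow> nat" where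
  "stage_length m1 s = 2 ^ (s - 1) * m1"

text \<open>
  The joint law of the pair of outputs (the \<open>x\<close>- and the \<open>v\<close>-iterate) of stage \<open>s\<close>, starting
  from \<open>xinit\<close>. It has finite support, so all expectations exist.
\<close>

primrec svrda ::
  "'a::real_inner set \<Rightarrow> nat \<Rightarrow> (nat \<Rightarrow> 'a \<Rightarrow> real) \<Rightarrow> (nat \<Rightarrow> real) \<Rightarrow> ('a \<Rightarrow> real) \<Rightarrow> real \<Rightarrow>
   nat \<Rightarrow> real \<Rightarrow> 'a \<Rightarrow> nat \<Rightarrow> ('a \<times> 'a) pmf"
where
  "svrda E n f L R \<eta> m1 \<alpha> xinit 0 = return_pmf (xinit, xinit)"
| "svrda E n f L R \<eta> m1 \<alpha> xinit (Suc s) =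
     do { (x, v) \<leftarrow> svrda E n f L R \<eta> m1 \<alpha> xinit s;
          (gbar, x', v', u) \<leftarrow>
            svrda_inner E n f L R \<eta> x ((1 - \<alpha>) *\<^sub>R v + \<alpha> *\<^sub>R x) (stage_length m1 (Suc s));
          return_pmf (x', v') }"

definition expected_gap ::
  "'a::real_inner set \<Rightarrow> nat \<Rightarrow> (nat \<Rightarrow> 'a \<Rightarrow> real) \<Rightarrow> (nat \<Rightarrow> real) \<Rightarrow> ('a \<Rightarrow> real) \<Rightarrow> real \<Rightarrow>
   nat \<Rightarrow> real \<Rightarrow> 'a \<Rightarrow> 'a \<Rightarrow> nat \<Rightarrow> real"
where
  "expected_gap E n f L R \<eta> m1 \<alpha> xinit xs S =
     measure_pmf.expectation (svrda E n f L R \<eta> m1 \<alpha> xinit S)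
       (\<lambda>(x, v). objective n f R x - objective n f R xs)"

text \<open>Full gradient (\<open>n\<close> evaluations) plus two component gradients per inner iteration.\<close>

definition grad_evals :: "nat \<Rightarrow> nat \<Rightarrow> nat \<Rightarrow> nat" where
  "grad_evals n m1 S = (\<Sum>s=1..S. n + 2 * stage_length m1 s)"

definition initial_bound ::
  "nat \<Rightarrow> (nat \<Rightarrow> 'a::real_inner \<Rightarrow> real) \<Rightarrow> (nat \<Rightarrow> real) \<Rightarrow> ('a \<Rightarrow> real) \<Rightarrow> nat \<Rightarrow> 'a \<Rightarrow> 'a \<Rightarrow> real"
where
  "initial_bound n f L R m1 xinit xs =
     objective n f R xinit - objective n f R xs
       + 4 * avg_L n L / real m1 * (norm (xinit - xs))\<^sup>2"

end

theory Submission
  imports Defs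
begin

text \<open>
  The proof is a potential argument on two levels. Write \<open>P\<^sub>*\<close> for the minimum of \<open>P\<close>.

  Within a stage, the potential after \<open>t\<close> iterations is \<open>t * (P x\<^sub>t - P\<^sub>*) + \<psi>\<^sub>t x\<^sub>* - \<psi>\<^sub>t v\<^sub>t\<close>, where
  \<open>\<psi>\<^sub>t z = t * (inner gbar\<^sub>t z + R z) + \<eta> / 2 * \<parallel>z - v\<^sub>0\<parallel>\<^sup>2\<close> is the model minimised by the dual
  averaging step. With exact gradients it would not increase; this is the usual accelerated
  argument, in which the primal step is compared with the convex combination of \<open>x\<^sub>t\<^sub>-\<^sub>1\<close> and \<open>v\<^sub>t\<close>
  (\<open>svrda_step_potential\<close>). With the stochastic gradient the linear error has mean zero, and the
  quadratic error contributes \<open>1 / (6 * Lb)\<close> times the variance. Cocoercivity of the component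
  gradients bounds this contribution by a Bregman distance, which convexity of \<open>F\<close> supplies at every
  step, plus half of the gap \<open>P x\<^sub>0 - P\<^sub>*\<close> at the start of the stage (\<open>estimate_variance\<close>). Hence the
  expected potential grows by at most half of that gap per iteration (\<open>expected_step_potential\<close>).

  The potential starts at \<open>\<eta> / 2 * \<parallel>v\<^sub>0 - x\<^sub>*\<parallel>\<^sup>2\<close> and after \<open>m\<close> iterations is at least
  \<open>m * (P x\<^sub>m - P\<^sub>*) + \<eta> / 2 * \<parallel>v\<^sub>m - x\<^sub>*\<parallel>\<^sup>2\<close>, because the model is strongly convex. After division
  by \<open>m\<close>, and since the next stage has length \<open>2 * m\<close>, this says that the gap plus \<open>\<eta>\<close> over the
  length of the coming stage times the squared distance of \<open>v\<close> to \<open>x\<^sub>*\<close> halves in expectation from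
  one stage to the next (\<open>stage_contraction\<close>). Its initial value is the bracket in the theorem.

  About \<open>log\<^sub>2 (D / \<epsilon>)\<close> stages therefore suffice. The full gradients contribute \<open>n\<close> evaluations per
  stage, and the stage lengths form a geometric sum of order \<open>m1 * D / \<epsilon>\<close>.

  The argument needs the minimisation steps of the algorithm to have solutions. As \<open>R\<close> is merely
  convex, this rests on a linear lower bound for convex functions on finite-dimensional spaces
  (\<open>convex_minorant\<close>) and on completeness of these spaces (\<open>prox_exists\<close>).
\<close>


section \<open>Convex functions on a finite-dimensional subspace\<close>

lemma le_if_le_add_small:
  fixes a b k :: real
  assumes "\<And>t. 0 < t \<Longrightarrow> t < 1 \<Longrightarrow> a \<le> b + t * k"
  shows "a \<le> b"
proof (rule tendsto_lowerbound)
  show "((\<lambda>t. b + t * k) \<longlongrightarrow> b) (at_right 0)"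
    by (auto intro!: tendsto_eq_intros)
  show "\<forall>\<^sub>F t in at_right 0. a \<le> b + t * k"
    unfolding eventually_at_right_field using assms by (intro exI[of _ 1]) auto
qed simp

lemma norm_sq_convex_comb:
  fixes x y w :: "'a::real_inner"
  shows "(norm ((1 - t) *\<^sub>R x + t *\<^sub>R y - w))\<^sup>2
    = (1 - t) * (norm (x - w))\<^sup>2 + t * (norm (y - w))\<^sup>2 - t * (1 - t) * (norm (x - y))\<^sup>2"
  unfolding power2_norm_eq_inner
  by (simp add: inner_add_left inner_add_right inner_diff_left inner_diff_right inner_commute
      algebra_simps)

text \<open>
  The identity \<open>expand\<close> says that \<open>B\<close> is a finite Parseval frame of \<open>E\<close>; an orthonormal basis is
  the example of interest. It turns completeness, the Riesz representation and the continuity of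
  convex functions into statements about finitely many coordinates.
\<close>

locale finite_frame =
  fixes E B :: "'a::real_inner set"
  assumes subspace: "subspace E"
    and finite_B: "finite B"
    and B_subset: "B \<subseteq> E"
    and expand: "x \<in> E \<Longrightarrow> x = (\<Sum>b\<in>B. inner x b *\<^sub>R b)"
begin

lemma convex_E: "convex E"
  using subspace by (rule subspace_imp_convex)

lemmas E_intros = subspace_add[OF subspace] subspace_diff[OF subspace] subspace_scale[OF subspace]
  subspace_0[OF subspace] subspace_neg[OF subspace] subspace_sum[OF subspace]

lemma Cauchy_converges:
  assumes X: "\<And>k. X k \<in> E" and "Cauchy X"
  obtains z where "z \<in> E" "X \<longlonglongrightarrow> z"
proof -
  have "\<exists>l. (\<lambda>k. inner (X k) b) \<longlonglongrightarrow> l" for b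
    using bounded_linear.Cauchy[OF bounded_linear_inner_left \<open>Cauchy X\<close>, of b]
    by (simp add: Cauchy_convergent_iff convergent_def)
  then obtain l where l: "\<And>b. (\<lambda>k. inner (X k) b) \<longlonglongrightarrow> l b" by metis
  have "(\<lambda>k. \<Sum>b\<in>B. inner (X k) b *\<^sub>R b) \<longlonglongrightarrow> (\<Sum>b\<in>B. l b *\<^sub>R b)"
    by (intro tendsto_sum tendsto_scaleR l tendsto_const)
  then have "X \<longlonglongrightarrow> (\<Sum>b\<in>B. l b *\<^sub>R b)"
    using expand[OF X] by simp
  moreover have "(\<Sum>b\<in>B. l b *\<^sub>R b) \<in> E"
    using B_subset by (intro E_intros) auto
  ultimately show ?thesis using that by blast
qed

text \<open>
  A convex function is bounded above on the cross-polytope with vertices \<open>z \<plusminus> b\<close>. For a direction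
  \<open>h\<close> of size \<open>s\<close>, the point \<open>z\<close> lies between \<open>z + h\<close> and the point \<open>z - h / s\<close> of that
  polytope, which bounds the value at \<open>z + h\<close> from below. This bound makes proximal objectives both
  bounded below and lower semicontinuous.
\<close>

lemma convex_minorant:
  assumes h: "convex_on E h" and z: "z \<in> E"
  obtains K where "K \<ge> 0" "\<And>y. y \<in> E \<Longrightarrow> h y \<ge> h z - K * norm (y - z)"
proof -
  define M where "M = \<bar>h z\<bar> + (\<Sum>b\<in>B. \<bar>h (z + b)\<bar> + \<bar>h (z - b)\<bar>)"
  define N where "N = (\<Sum>b\<in>B. norm b)"
  have "M \<ge> \<bar>h z\<bar>" by (simp add: M_def sum_nonneg)
  have "N \<ge> 0" by (simp add: N_def sum_nonneg)
  have vertex: "h (z - sgn c *\<^sub>R b) \<le> M" if "b \<in> B" for b and c :: real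
  proof -
    have "\<bar>h (z + b)\<bar> + \<bar>h (z - b)\<bar> \<le> (\<Sum>b\<in>B. \<bar>h (z + b)\<bar> + \<bar>h (z - b)\<bar>)"
      using that finite_B by (intro member_le_sum) auto
    then show ?thesis unfolding M_def by (auto simp: sgn_if)
  qed
  have "h y \<ge> h z - N * (M - h z) * norm (y - z)" if y: "y \<in> E" for y
  proof (cases "y = z")
    case False
    define d where "d = y - z"
    define s where "s = (\<Sum>b\<in>B. \<bar>inner d b\<bar>)"
    have d: "d \<in> E" "d \<noteq> 0" using y z False by (auto simp: d_def intro!: E_intros)
    have "s \<ge> 0" by (simp add: s_def sum_nonneg)
    have "s \<noteq> 0"
    proof
      assume "s = 0"
      then have "\<forall>b\<in>B. inner d b = 0" using finite_B by (simp add: s_def sum_nonneg_eq_0_iff)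
      then show False using expand[OF d(1)] d(2) by simp
    qed
    with \<open>s \<ge> 0\<close> have s: "s > 0" by simp
    have "s \<le> N * norm d"
      unfolding s_def N_def sum_distrib_right
      by (intro sum_mono) (metis Cauchy_Schwarz_ineq2 mult.commute)
    define w where "w = (\<Sum>b\<in>B. (\<bar>inner d b\<bar> / s) *\<^sub>R (z - sgn (inner d b) *\<^sub>R b))"
    have one: "(\<Sum>b\<in>B. \<bar>inner d b\<bar> / s) = 1"
      using s by (simp add: s_def flip: sum_divide_distrib)
    have "w = (\<Sum>b\<in>B. (\<bar>inner d b\<bar> / s) *\<^sub>R z) - (1 / s) *\<^sub>R (\<Sum>b\<in>B. inner d b *\<^sub>R b)"
      unfolding w_def scaleR_sum_right sum_subtractf[symmetric]
      by (intro sum.cong refl) (auto simp: algebra_simps sgn_if abs_if)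
    also have "\<dots> = z - (1 / s) *\<^sub>R d"
      using one expand[OF d(1)] by (simp flip: scaleR_sum_left)
    finally have w: "w = z - (1 / s) *\<^sub>R d" .
    have "h w \<le> (\<Sum>b\<in>B. \<bar>inner d b\<bar> / s * h (z - sgn (inner d b) *\<^sub>R b))"
      unfolding w_def
    proof (rule convex_on_sum[OF finite_B _ h one])
      show "B \<noteq> {}" using one by force
    qed (use s z B_subset in \<open>auto intro!: E_intros\<close>)
    also have "\<dots> \<le> (\<Sum>b\<in>B. \<bar>inner d b\<bar> / s * M)"
      using s by (intro sum_mono mult_left_mono vertex) auto
    also have "\<dots> = M" using one by (metis sum_distrib_right mult_1)
    finally have hw: "h w \<le> M" .
    define q where "q = s / (1 + s)"
    have q: "0 \<le> q" "q \<le> 1" "q * (1 / s) = 1 - q"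
      using s by (auto simp: q_def field_simps)
    have "(1 - q) *\<^sub>R y + q *\<^sub>R w = z + ((1 - q) - q * (1 / s)) *\<^sub>R d"
      by (simp add: w d_def algebra_simps)
    then have z_eq: "z = (1 - q) *\<^sub>R y + q *\<^sub>R w" by (simp only: q) simp
    have "w \<in> E" using z d by (auto simp: w intro!: E_intros)
    then have "h z \<le> (1 - q) * h y + q * h w"
      using convex_onD[OF h q(1,2) y] z_eq by metis
    also have "\<dots> \<le> (1 - q) * h y + q * M"
      using hw q by (intro add_left_mono mult_left_mono) auto
    finally have "(1 + s) * h z \<le> (1 + s) * ((1 - q) * h y + q * M)"
      using s by (intro mult_left_mono) auto
    also have "\<dots> = ((1 + s) * (1 - q)) * h y + ((1 + s) * q) * M" by (simp add: algebra_simps)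
    also have "(1 + s) * q = s" using s by (simp add: q_def)
    also have "(1 + s) * (1 - q) = 1" using s by (simp add: q_def field_simps)
    finally have "(1 + s) * h z \<le> h y + s * M" by simp
    then have "h z - s * (M - h z) \<le> h y" by (simp add: algebra_simps)
    moreover have "s * (M - h z) \<le> N * norm d * (M - h z)"
      using \<open>s \<le> N * norm d\<close> \<open>M \<ge> \<bar>h z\<bar>\<close> by (intro mult_right_mono) auto
    ultimately show ?thesis by (simp add: d_def algebra_simps)
  qed simp
  moreover have "N * (M - h z) \<ge> 0" using \<open>N \<ge> 0\<close> \<open>M \<ge> \<bar>h z\<bar>\<close> by simp
  ultimately show ?thesis using that by blast
qed

lemma convex_on_prox_objective:
  assumes h: "convex_on E h" and "c \<ge> 0"
  shows "convex_on E (\<lambda>z. inner a z + h z + c * (norm (z - w))\<^sup>2)"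
proof (rule convex_onI[OF _ convex_E])
  fix t x y assume t: "0 < t" "t < (1::real)" and xy: "x \<in> E" "y \<in> E"
  have "0 \<le> c * (t * (1 - t) * (norm (x - y))\<^sup>2)"
    using t assms(2) by simp
  then show "inner a ((1 - t) *\<^sub>R x + t *\<^sub>R y) + h ((1 - t) *\<^sub>R x + t *\<^sub>R y)
        + c * (norm ((1 - t) *\<^sub>R x + t *\<^sub>R y - w))\<^sup>2
      \<le> (1 - t) * (inner a x + h x + c * (norm (x - w))\<^sup>2)
        + t * (inner a y + h y + c * (norm (y - w))\<^sup>2)"
    using convex_onD[OF h, of t x y] t xy
    unfolding norm_sq_convex_comb by (simp add: algebra_simps)
qed

text \<open>
  A minimising sequence is Cauchy because the quadratic term makes the objective strongly convex,
  and the linear minorant at its limit shows that the infimum is attained there.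
\<close>

lemma prox_exists:
  assumes h: "convex_on E h" and c: "c > 0" and w: "w \<in> E"
  shows "\<exists>v. is_arg_min (\<lambda>z. inner a z + h z + c * (norm (z - w))\<^sup>2) (\<lambda>z. z \<in> E) v"
proof -
  define \<phi> where "\<phi> = (\<lambda>z. inner a z + h z + c * (norm (z - w))\<^sup>2)"
  have \<phi>: "convex_on E \<phi>"
    unfolding \<phi>_def using h c by (intro convex_on_prox_objective) auto
  have mid: "\<phi> ((1/2) *\<^sub>R x + (1/2) *\<^sub>R y) \<le> (\<phi> x + \<phi> y) / 2 - c / 4 * (norm (x - y))\<^sup>2"
    if "x \<in> E" "y \<in> E" for x y
  proof -
    have "(norm ((1/2) *\<^sub>R x + (1/2) *\<^sub>R y - w))\<^sup>2
        = ((norm (x - w))\<^sup>2 + (norm (y - w))\<^sup>2) / 2 - (norm (x - y))\<^sup>2 / 4"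
      using norm_sq_convex_comb[of "1/2" x y w] by simp
    moreover have "h ((1/2) *\<^sub>R x + (1/2) *\<^sub>R y) \<le> (h x + h y) / 2"
      using convex_onD[OF h, of "1/2" x y] that by simp
    ultimately show ?thesis
      by (simp add: \<phi>_def inner_add_right right_diff_distrib distrib_left add_divide_distrib)
  qed
  obtain K where K: "K \<ge> 0" "\<And>y. y \<in> E \<Longrightarrow> \<phi> y \<ge> \<phi> w - K * norm (y - w)"
    using convex_minorant[OF \<phi> w] by blast
  \<comment> \<open>Applied to the midpoint of \<open>w\<close> and \<open>y\<close>, the linear minorant competes with a quadratic gain.\<close>
  have "bdd_below (\<phi> ` E)"
  proof (rule bdd_belowI2)
    fix y assume y: "y \<in> E"
    define r where "r = norm (y - w)"
    define p where "p = (1/2) *\<^sub>R y + (1/2) *\<^sub>R w"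
    have "p \<in> E" using y w by (auto simp: p_def intro!: E_intros)
    have "p - w = (1/2) *\<^sub>R (y - w)"
      using scaleR_half_double[of w] by (simp add: p_def algebra_simps)
    then have "norm (p - w) = r / 2" by (simp add: r_def)
    then have "\<phi> w - K * (r / 2) \<le> \<phi> p" using K(2)[OF \<open>p \<in> E\<close>] by metis
    also have "\<dots> \<le> (\<phi> y + \<phi> w) / 2 - c / 4 * r\<^sup>2"
      using mid[OF y w] by (simp add: p_def r_def)
    finally have "\<phi> w - K * (r / 2) \<le> (\<phi> y + \<phi> w) / 2 - c / 4 * r\<^sup>2" .
    then have "\<phi> y \<ge> \<phi> w - K * r + c / 2 * r\<^sup>2" by (simp add: field_simps)
    moreover have "- K * r + c / 2 * r\<^sup>2 = c / 2 * (r - K / c)\<^sup>2 - K\<^sup>2 / (2 * c)"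
      using c by (simp add: power2_eq_square field_simps)
    moreover have "c / 2 * (r - K / c)\<^sup>2 \<ge> 0" using c by simp
    ultimately show "\<phi> w - K\<^sup>2 / (2 * c) \<le> \<phi> y" by linarith
  qed
  define m where "m = Inf (\<phi> ` E)"
  have m: "m \<le> \<phi> y" if "y \<in> E" for y
    unfolding m_def using \<open>bdd_below (\<phi> ` E)\<close> that by (rule cINF_lower)
  have "\<exists>x\<in>E. \<phi> x < m + inverse (real (Suc k))" for k
  proof -
    have "Inf (\<phi> ` E) < m + inverse (real (Suc k))" by (simp add: m_def)
    then show ?thesis using cINF_less_iff[OF _ \<open>bdd_below (\<phi> ` E)\<close>] w by blast
  qed
  then obtain X where X: "\<And>k. X k \<in> E" "\<And>k. \<phi> (X k) < m + inverse (real (Suc k))"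
    by metis
  have close: "(norm (x - y))\<^sup>2 \<le> 4 / c * \<delta>"
    if "x \<in> E" "y \<in> E" "\<phi> x \<le> m + \<delta>" "\<phi> y \<le> m + \<delta>" for x y \<delta>
  proof -
    have "m \<le> \<phi> ((1/2) *\<^sub>R x + (1/2) *\<^sub>R y)" using that by (intro m E_intros)
    also have "\<dots> \<le> (\<phi> x + \<phi> y) / 2 - c / 4 * (norm (x - y))\<^sup>2" by (rule mid) fact+
    also have "(\<phi> x + \<phi> y) / 2 \<le> m + \<delta>" using that(3,4) by simp
    finally show ?thesis using c by (simp add: field_simps)
  qed
  have "Cauchy X"
  proof (rule metric_CauchyI)
    fix e :: real assume "e > 0"
    then have "e\<^sup>2 * c / 4 > 0" using c by simp
    then obtain M where M: "inverse (real (Suc M)) < e\<^sup>2 * c / 4" using reals_Archimedean by blast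
    have near: "\<phi> (X k) \<le> m + inverse (real (Suc M))" if "k \<ge> M" for k
    proof -
      have "inverse (real (Suc k)) \<le> inverse (real (Suc M))"
        using that by (intro le_imp_inverse_le) auto
      then show ?thesis using X(2)[of k] by linarith
    qed
    have "dist (X i) (X j) < e" if "i \<ge> M" "j \<ge> M" for i j
    proof -
      have "(norm (X i - X j))\<^sup>2 \<le> 4 / c * inverse (real (Suc M))"
        using X(1) near that by (intro close) auto
      also have "\<dots> < 4 / c * (e\<^sup>2 * c / 4)"
        using M c by (intro mult_strict_left_mono) auto
      also have "\<dots> = e\<^sup>2" using c by simp
      finally show ?thesis
        using \<open>e > 0\<close> by (simp add: dist_norm power2_less_imp_less)
    qed
    then show "\<exists>M. \<forall>i\<ge>M. \<forall>j\<ge>M. dist (X i) (X j) < e" by blast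
  qed
  then obtain z where z: "z \<in> E" "X \<longlonglongrightarrow> z" using Cauchy_converges X(1) by blast
  obtain K' where K': "\<And>y. y \<in> E \<Longrightarrow> \<phi> y \<ge> \<phi> z - K' * norm (y - z)"
    using convex_minorant[OF \<phi> z(1)] by blast
  have "\<phi> z \<le> m"
  proof (rule LIMSEQ_le_const)
    have "(\<lambda>k. m + inverse (real (Suc k)) + K' * norm (X k - z))
        \<longlonglongrightarrow> m + 0 + K' * norm (z - z)"
      by (intro tendsto_add tendsto_const tendsto_mult tendsto_norm tendsto_diff z
          LIMSEQ_inverse_real_of_nat)
    then show "(\<lambda>k. m + inverse (real (Suc k)) + K' * norm (X k - z)) \<longlonglongrightarrow> m"
      by simp
    have "\<phi> z \<le> m + inverse (real (Suc k)) + K' * norm (X k - z)" for k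
      using X(2)[of k] K'[OF X(1)[of k]] by linarith
    then show "\<exists>N. \<forall>k\<ge>N. \<phi> z \<le> m + inverse (real (Suc k)) + K' * norm (X k - z)"
      by blast
  qed
  then have "is_arg_min \<phi> (\<lambda>z. z \<in> E) z"
    using m z(1) by (force simp: is_arg_min_linorder)
  then show ?thesis unfolding \<phi>_def by blast
qed

text \<open>
  By strong convexity, the objective at a point exceeds its minimum by the quadratic term centred at
  the minimiser: compare the minimiser with points on the segment towards the other point.
\<close>

lemma prox_growth:
  fixes a :: "'a"
  assumes h: "convex_on E h" and w: "w \<in> E" and c: "c > 0" and z: "z \<in> E"
  defines "\<phi> \<equiv> \<lambda>z. inner a z + h z + c * (norm (z - w))\<^sup>2"
  defines "v \<equiv> arg_min_on \<phi> E"
  shows "v \<in> E" and "\<phi> v + c * (norm (z - v))\<^sup>2 \<le> \<phi> z"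
proof -
  have "is_arg_min \<phi> (\<lambda>z. z \<in> E) v"
    using prox_exists[OF h c w, of a] unfolding v_def arg_min_on_def arg_min_def \<phi>_def
    by (rule someI_ex)
  then have v: "v \<in> E" "\<And>y. y \<in> E \<Longrightarrow> \<phi> v \<le> \<phi> y" by (auto simp: is_arg_min_linorder)
  show "v \<in> E" by fact
  show "\<phi> v + c * (norm (z - v))\<^sup>2 \<le> \<phi> z"
  proof (rule le_if_le_add_small)
    fix t :: real assume t: "0 < t" "t < 1"
    have "\<phi> v \<le> \<phi> ((1 - t) *\<^sub>R v + t *\<^sub>R z)"
      using v z by (intro v(2) E_intros)
    also have "\<dots> \<le> (1 - t) * \<phi> v + t * \<phi> z - t * (1 - t) * (c * (norm (z - v))\<^sup>2)"
      using convex_onD[OF h, of t v z] t v(1) z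
      unfolding \<phi>_def norm_sq_convex_comb by (simp add: algebra_simps norm_minus_commute)
    finally have "t * (\<phi> v + c * (norm (z - v))\<^sup>2) \<le> t * (\<phi> z + t * (c * (norm (z - v))\<^sup>2))"
      by (simp add: algebra_simps)
    then show "\<phi> v + c * (norm (z - v))\<^sup>2 \<le> \<phi> z + t * (c * (norm (z - v))\<^sup>2)"
      using t by simp
  qed
qed

section \<open>Gradients and smoothness\<close>

lemma has_derivative_along_line:
  assumes f: "(f has_derivative (\<lambda>y. inner g y)) (at (x + t *\<^sub>R d) within E)"
    and x: "x \<in> E" and d: "d \<in> E"
  shows "((\<lambda>t. f (x + t *\<^sub>R d)) has_real_derivative inner g d) (at t)"
proof -
  have sub: "range (\<lambda>t. x + t *\<^sub>R d) \<subseteq> E" using x d by (auto intro!: E_intros)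
  have "((\<lambda>t. x + t *\<^sub>R d) has_derivative (\<lambda>s. s *\<^sub>R d)) (at t)"
    by (auto intro!: derivative_eq_intros)
  from has_derivative_in_compose[OF this has_derivative_subset[OF f sub]] show ?thesis
    by (simp add: has_field_derivative_def mult_commute_abs)
qed

lemma gradient_unique:
  assumes "(f has_derivative (\<lambda>y. inner g y)) (at x within E)" "g \<in> E"
    and "(f has_derivative (\<lambda>y. inner g' y)) (at x within E)" "g' \<in> E" and x: "x \<in> E"
  shows "g = g'"
proof -
  have "g - g' \<in> E" using assms by (intro E_intros)
  then have "inner g (g - g') = inner g' (g - g')"
    using has_derivative_along_line[of f g x 0 "g - g'"] has_derivative_along_line[of f g' x 0 "g - g'"]
      assms by (intro DERIV_unique) auto
  then have "inner (g - g') (g - g') = 0" by (simp only: inner_diff_left)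
  then show ?thesis by simp
qed

lemma grad_eqI:
  assumes "(f has_derivative (\<lambda>y. inner g y)) (at x within E)" "g \<in> E" "x \<in> E"
  shows "grad E f x = g"
  unfolding grad_def
  by (rule the_equality) (use assms in \<open>auto intro: gradient_unique[OF _ _ assms]\<close>)

text \<open>The gradient is the Riesz representative of the derivative on \<open>E\<close>.\<close>

lemma grad:
  assumes f: "f differentiable_on E" and x: "x \<in> E"
  shows grad_in: "grad E f x \<in> E"
    and grad_has_derivative: "(f has_derivative (\<lambda>y. inner (grad E f x) y)) (at x within E)"
proof -
  obtain D where D: "(f has_derivative D) (at x within E)"
    using f x unfolding differentiable_on_def differentiable_def by blast
  interpret D: bounded_linear D using D by (rule has_derivative_bounded_linear)
  define g where "g = (\<Sum>b\<in>B. D b *\<^sub>R b)"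
  have g: "g \<in> E" using B_subset by (auto simp: g_def intro!: E_intros)
  have gD: "inner g y = D y" if "y \<in> E" for y
  proof -
    have "D y = D (\<Sum>b\<in>B. inner y b *\<^sub>R b)" using expand[OF that] by simp
    also have "\<dots> = (\<Sum>b\<in>B. D b * inner b y)"
      by (simp add: D.sum D.scaleR inner_commute[of y] mult.commute)
    also have "\<dots> = inner g y" by (simp add: g_def inner_sum_left)
    finally show ?thesis by simp
  qed
  have "(f has_derivative (\<lambda>y. inner g y)) (at x within E)"
    unfolding has_derivative_within
  proof
    show "((\<lambda>y. (1 / norm (y - x)) *\<^sub>R (f y - (f x + inner g (y - x)))) \<longlongrightarrow> 0) (at x within E)"
    proof (rule Lim_transform_within[OF _ zero_less_one])
      show "((\<lambda>y. (1 / norm (y - x)) *\<^sub>R (f y - (f x + D (y - x)))) \<longlongrightarrow> 0) (at x within E)"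
        using D unfolding has_derivative_within by blast
    qed (use x in \<open>auto simp: gD E_intros\<close>)
  qed (rule bounded_linear_inner_right)
  moreover from this have "grad E f x = g" using g x by (rule grad_eqI)
  ultimately show "grad E f x \<in> E"
    "(f has_derivative (\<lambda>y. inner (grad E f x) y)) (at x within E)" using g by auto
qed

lemma grad_along_line:
  assumes f: "f differentiable_on E" and x: "x \<in> E" and d: "d \<in> E"
  shows "((\<lambda>t. f (x + t *\<^sub>R d)) has_real_derivative inner (grad E f (x + t *\<^sub>R d)) d) (at t)"
  using assms by (intro has_derivative_along_line grad_has_derivative E_intros) auto

end

definition bregman :: "'a::real_inner set \<Rightarrow> ('a \<Rightarrow> real) \<Rightarrow> 'a \<Rightarrow> 'a \<Rightarrow> real" where
  "bregman E f y x = f y - f x - inner (grad E f x) (y - x)"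

context finite_frame
begin

lemma bregman_nonneg:
  assumes f: "convex_on E f" "f differentiable_on E" and x: "x \<in> E" and y: "y \<in> E"
  shows "bregman E f y x \<ge> 0"
proof -
  let ?\<phi> = "\<lambda>t. f (x + t *\<^sub>R (y - x))"
  have d: "y - x \<in> E" using x y by (intro E_intros)
  have "convex_on UNIV ?\<phi>"
  proof (rule convex_onI)
    fix t r s :: real assume t: "0 < t" "t < 1"
    have "x + ((1 - t) * r + t * s) *\<^sub>R (y - x)
        = (1 - t) *\<^sub>R (x + r *\<^sub>R (y - x)) + t *\<^sub>R (x + s *\<^sub>R (y - x))"
      by (simp add: algebra_simps)
    then show "?\<phi> ((1 - t) *\<^sub>R r + t *\<^sub>R s) \<le> (1 - t) * ?\<phi> r + t * ?\<phi> s"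
      using t x d by (auto intro!: convex_onD[OF f(1)] E_intros)
  qed simp
  moreover have "(?\<phi> has_real_derivative inner (grad E f x) (y - x)) (at 0)"
    using grad_along_line[OF f(2) x d, of 0] by simp
  ultimately have "?\<phi> 1 - ?\<phi> 0 \<ge> inner (grad E f x) (y - x) * (1 - 0)"
    by (intro convex_on_imp_above_tangent[where A = UNIV and f = ?\<phi>]) auto
  then show ?thesis by (simp add: bregman_def)
qed

lemma bregman_le:
  assumes f: "f differentiable_on E" and L: "L-lipschitz_on E (grad E f)"
    and x: "x \<in> E" and y: "y \<in> E"
  shows "bregman E f y x \<le> L / 2 * (norm (y - x))\<^sup>2"
proof -
  define d where "d = y - x"
  have d: "d \<in> E" using x y by (auto simp: d_def intro!: E_intros)
  let ?\<psi> = "\<lambda>t. f (x + t *\<^sub>R d) - t * inner (grad E f x) d - L / 2 * t\<^sup>2 * (norm d)\<^sup>2"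
  have "?\<psi> 1 \<le> ?\<psi> 0"
  proof (rule DERIV_nonpos_imp_nonincreasing[where f = ?\<psi>])
    fix t :: real assume t: "0 \<le> t" "t \<le> 1"
    let ?D = "inner (grad E f (x + t *\<^sub>R d)) d - inner (grad E f x) d - L * t * (norm d)\<^sup>2"
    have "(?\<psi> has_real_derivative ?D) (at t)"
      by (auto intro!: derivative_eq_intros grad_along_line[OF f x d])
    moreover have "?D \<le> 0"
    proof -
      have "inner (grad E f (x + t *\<^sub>R d) - grad E f x) d
          \<le> norm (grad E f (x + t *\<^sub>R d) - grad E f x) * norm d"
        by (rule norm_cauchy_schwarz)
      also have "\<dots> \<le> (L * norm (t *\<^sub>R d)) * norm d"
        using lipschitz_onD[OF L, of "x + t *\<^sub>R d" x] x d
        by (intro mult_right_mono) (auto simp: dist_norm intro!: E_intros)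
      also have "\<dots> = L * t * (norm d)\<^sup>2" using t by (simp add: power2_eq_square)
      finally show ?thesis by (simp add: inner_diff_left)
    qed
    ultimately show "\<exists>D. (?\<psi> has_real_derivative D) (at t) \<and> D \<le> 0" by blast
  qed simp
  then show ?thesis by (simp add: bregman_def d_def)
qed

text \<open>
  The function \<open>z \<mapsto> bregman E f z x\<close> is convex and smooth with minimum \<open>0\<close> at \<open>x\<close>. A gradient
  step of length \<open>1 / L\<close> from \<open>y\<close> decreases it by at least the left-hand side divided by \<open>2 * L\<close>.
\<close>

lemma cocoercive:
  assumes f: "convex_on E f" "f differentiable_on E" and L: "L-lipschitz_on E (grad E f)" "L > 0"
    and x: "x \<in> E" and y: "y \<in> E"
  shows "(norm (grad E f y - grad E f x))\<^sup>2 \<le> 2 * L * bregman E f y x"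
proof -
  define e where "e = grad E f y - grad E f x"
  define z where "z = y - (1 / L) *\<^sub>R e"
  have "e \<in> E" using x y f by (auto simp: e_def intro!: E_intros grad_in)
  then have z: "z \<in> E" using y by (auto simp: z_def intro!: E_intros)
  have "0 \<le> bregman E f z x" using f x z by (rule bregman_nonneg)
  also have "bregman E f z x = bregman E f y x + bregman E f z y + inner e (z - y)"
    by (simp add: bregman_def e_def algebra_simps)
  also have "bregman E f z y \<le> L / 2 * (norm (z - y))\<^sup>2"
    using f(2) L(1) y z by (rule bregman_le)
  also have "L / 2 * (norm (z - y))\<^sup>2 = (norm e)\<^sup>2 / (2 * L)"
    using L(2) by (simp add: z_def power_mult_distrib power2_eq_square field_simps)
  also have "inner e (z - y) = - (norm e)\<^sup>2 / L"
    by (simp add: z_def power2_norm_eq_inner)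
  finally show ?thesis using L(2) by (simp add: e_def field_simps)
qed

text \<open>
  First-order optimality of \<open>x\<close> for \<open>f + R\<close> makes \<open>- grad E f x\<close> a subgradient of \<open>R\<close> at \<open>x\<close>; it is
  obtained by moving a small step from \<open>x\<close> towards \<open>y\<close>, where smoothness makes the error of the
  linearisation of \<open>f\<close> quadratic in the step.
\<close>

lemma minimizer_excess_ge_bregman:
  assumes f: "convex_on E f" "f differentiable_on E"
    and smooth: "\<And>x y. x \<in> E \<Longrightarrow> y \<in> E \<Longrightarrow> bregman E f y x \<le> L / 2 * (norm (y - x))\<^sup>2"
    and R: "convex_on E R"
    and x: "x \<in> E" and min: "\<And>y. y \<in> E \<Longrightarrow> f x + R x \<le> f y + R y" and y: "y \<in> E"
  shows "bregman E f y x \<le> (f y + R y) - (f x + R x)"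
proof -
  have "R x \<le> R y + inner (grad E f x) (y - x)"
  proof (rule le_if_le_add_small)
    fix t :: real assume t: "0 < t" "t < 1"
    define p where "p = (1 - t) *\<^sub>R x + t *\<^sub>R y"
    have p: "p \<in> E" using x y by (auto simp: p_def intro!: E_intros)
    have px: "p - x = t *\<^sub>R (y - x)" by (simp add: p_def algebra_simps)
    have "f x + R x \<le> f p + R p" using p by (rule min)
    also have "f p \<le> f x + t * inner (grad E f x) (y - x) + L / 2 * t\<^sup>2 * (norm (y - x))\<^sup>2"
      using smooth[OF x p] t by (simp add: bregman_def px power_mult_distrib)
    also have "R p \<le> (1 - t) * R x + t * R y"
      unfolding p_def using t x y by (intro convex_onD[OF R]) auto
    finally have "t * R x
        \<le> t * (R y + inner (grad E f x) (y - x) + t * (L / 2 * (norm (y - x))\<^sup>2))"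
      by (simp add: algebra_simps power2_eq_square)
    then show "R x \<le> R y + inner (grad E f x) (y - x) + t * (L / 2 * (norm (y - x))\<^sup>2)"
      using t by simp
  qed
  then show ?thesis by (simp add: bregman_def)
qed

end

section \<open>The variance-reduced gradient estimator\<close>

locale finite_sum_problem = finite_frame E B for E B :: "'a::real_inner set" +
  fixes n :: nat and f :: "nat \<Rightarrow> 'a \<Rightarrow> real" and L :: "nat \<Rightarrow> real" and R :: "'a \<Rightarrow> real"
    and \<mu> :: real and xs :: 'a
  assumes problem: "problem E n f L R \<mu> xs"
begin

abbreviation "F \<equiv> avg_fun n f"
abbreviation "P \<equiv> objective n f R"
abbreviation "Lb \<equiv> avg_L n L"

lemma n_pos: "n \<ge> 1"
  and f_convex: "i \<in> {1..n} \<Longrightarrow> convex_on E (f i)"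
  and f_diff: "i \<in> {1..n} \<Longrightarrow> f i differentiable_on E"
  and L_pos: "i \<in> {1..n} \<Longrightarrow> L i > 0"
  and f_lipschitz: "i \<in> {1..n} \<Longrightarrow> (L i)-lipschitz_on E (grad E (f i))"
  and R_convex: "convex_on E R"
  and xs: "xs \<in> E"
  and xs_min: "y \<in> E \<Longrightarrow> P xs \<le> P y"
  using problem by (auto simp: problem_def strongly_convex_def is_arg_min_linorder)

lemma Lb_pos: "Lb > 0"
  unfolding avg_L_def using n_pos L_pos by (intro mult_pos_pos sum_pos) auto

lemma gap_nonneg: "y \<in> E \<Longrightarrow> 0 \<le> P y - P xs"
  using xs_min by simp

lemma F_derivative:
  assumes x: "x \<in> E"
  shows "(F has_derivative (\<lambda>y. inner ((1 / real n) *\<^sub>R (\<Sum>i=1..n. grad E (f i) x)) y)) (at x within E)"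
  unfolding avg_fun_def inner_scaleR_left inner_sum_left
  by (intro has_derivative_mult_right has_derivative_sum grad_has_derivative f_diff x)

lemma F_diff: "F differentiable_on E"
  using F_derivative unfolding differentiable_on_def differentiable_def by blast

lemma grad_F:
  assumes x: "x \<in> E"
  shows "grad E F x = (1 / real n) *\<^sub>R (\<Sum>i=1..n. grad E (f i) x)"
  using F_derivative[OF x] x by (intro grad_eqI) (auto intro!: E_intros grad_in f_diff)

lemma F_convex: "convex_on E F"
proof (rule convex_onI[OF _ convex_E])
  fix t x y assume t: "0 < t" "t < (1::real)" and xy: "x \<in> E" "y \<in> E"
  have "(\<Sum>i=1..n. f i ((1 - t) *\<^sub>R x + t *\<^sub>R y)) \<le> (\<Sum>i=1..n. (1 - t) * f i x + t * f i y)"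
    using t xy by (intro sum_mono convex_onD[OF f_convex]) auto
  also have "\<dots> = (1 - t) * (\<Sum>i=1..n. f i x) + t * (\<Sum>i=1..n. f i y)"
    by (simp add: sum.distrib sum_distrib_left)
  finally show "F ((1 - t) *\<^sub>R x + t *\<^sub>R y) \<le> (1 - t) * F x + t * F y"
    using n_pos by (simp add: avg_fun_def field_simps)
qed

lemma bregman_F:
  assumes "x \<in> E"
  shows "bregman E F y x = (1 / real n) * (\<Sum>i=1..n. bregman E (f i) y x)"
  unfolding bregman_def grad_F[OF assms] avg_fun_def inner_scaleR_left inner_sum_left sum_subtractf
  by (simp add: algebra_simps)

lemma bregman_F_le:
  assumes "x \<in> E" "y \<in> E"
  shows "bregman E F y x \<le> Lb / 2 * (norm (y - x))\<^sup>2"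
proof -
  have "(\<Sum>i=1..n. bregman E (f i) y x) \<le> (\<Sum>i=1..n. L i / 2 * (norm (y - x))\<^sup>2)"
    using assms by (intro sum_mono bregman_le f_diff f_lipschitz) auto
  also have "\<dots> = (\<Sum>i=1..n. L i) / 2 * (norm (y - x))\<^sup>2"
    by (simp add: sum_distrib_right sum_divide_distrib)
  finally show ?thesis
    using n_pos by (simp add: bregman_F[OF assms(1)] avg_L_def field_simps)
qed

lemma bregman_F_minimizer_le:
  assumes "y \<in> E"
  shows "bregman E F y xs \<le> P y - P xs"
  using minimizer_excess_ge_bregman[OF F_convex F_diff bregman_F_le R_convex xs _ assms] xs_min
  by (simp add: objective_def)

definition estimate :: "'a \<Rightarrow> 'a \<Rightarrow> nat \<Rightarrow> 'a" where
  "estimate x0 u i = (grad E (f i) u - grad E (f i) x0) /\<^sub>R (real n * weight n L i) + grad E F x0"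

lemma weight_pos: "i \<in> {1..n} \<Longrightarrow> weight n L i > 0"
  using n_pos L_pos Lb_pos by (auto simp: weight_def)

lemma sum_weight: "(\<Sum>i=1..n. weight n L i) = 1"
proof -
  have "(\<Sum>i=1..n. weight n L i) = (real n * Lb) / (real n * Lb)"
    using n_pos by (simp add: weight_def avg_L_def flip: sum_divide_distrib)
  then show ?thesis using n_pos Lb_pos by simp
qed

lemma pmf_Q_weight: "pmf (Q n L) i = (if i \<in> {1..n} then weight n L i else 0)"
  using n_pos L_pos by (rule pmf_Q)

lemma set_Q: "set_pmf (Q n L) \<subseteq> {1..n}"
  by (auto simp: set_pmf_eq pmf_Q_weight)

lemma expectation_Q: "measure_pmf.expectation (Q n L) h = (\<Sum>i=1..n. weight n L i * h i)"
  for h :: "nat \<Rightarrow> real"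
proof -
  have "measure_pmf.expectation (Q n L) h = (\<Sum>i=1..n. h i * pmf (Q n L) i)"
    using set_Q by (intro integral_measure_pmf_real) auto
  also have "\<dots> = (\<Sum>i=1..n. weight n L i * h i)"
    by (intro sum.cong refl) (simp add: pmf_Q_weight)
  finally show ?thesis .
qed

lemma estimate_unbiased:
  assumes "x0 \<in> E" "u \<in> E"
  shows "(\<Sum>i=1..n. weight n L i *\<^sub>R estimate x0 u i) = grad E F u"
proof -
  have "(\<Sum>i=1..n. weight n L i *\<^sub>R estimate x0 u i)
      = (\<Sum>i=1..n. (1 / real n) *\<^sub>R (grad E (f i) u - grad E (f i) x0)) + grad E F x0"
  proof -
    have "weight n L i *\<^sub>R estimate x0 u i
        = (1 / real n) *\<^sub>R (grad E (f i) u - grad E (f i) x0) + weight n L i *\<^sub>R grad E F x0"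
      if "i \<in> {1..n}" for i
      using weight_pos[OF that] by (simp add: estimate_def scaleR_add_right field_simps)
    then show ?thesis
      using sum_weight by (simp add: sum.distrib flip: scaleR_sum_left)
  qed
  also have "\<dots> = grad E F u"
    using assms by (simp add: grad_F sum_subtractf algebra_simps flip: scaleR_sum_right)
  finally show ?thesis .
qed

text \<open>
  The difference of the component gradients at \<open>u\<close> and \<open>x0\<close> is split at the minimiser, using
  \<open>\<parallel>a + b\<parallel>\<^sup>2 \<le> 3 * \<parallel>a\<parallel>\<^sup>2 + 3 / 2 * \<parallel>b\<parallel>\<^sup>2\<close>, and cocoercivity bounds both parts. For the step
  size \<open>4 * Lb\<close> the variance enters the analysis divided by \<open>6 * Lb\<close>. The coefficient \<open>6\<close> is then
  the largest one whose term is covered by the Bregman distance that convexity of \<open>F\<close> provides, and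
  the coefficient \<open>3\<close> produces the factor one half by which a stage contracts the gap. Splitting
  with weights \<open>2, 2\<close> would give two thirds.
\<close>

lemma estimate_variance:
  assumes x0: "x0 \<in> E" and u: "u \<in> E"
  shows "(\<Sum>i=1..n. weight n L i * (norm (estimate x0 u i - grad E F u))\<^sup>2)
    \<le> Lb * (6 * bregman E F xs u + 3 * bregman E F x0 xs)"
proof -
  define \<xi> where "\<xi> i = (grad E (f i) u - grad E (f i) x0) /\<^sub>R (real n * weight n L i)" for i
  define m where "m = grad E F u - grad E F x0"
  have est: "estimate x0 u i - grad E F u = \<xi> i - m" for i
    by (simp add: estimate_def \<xi>_def m_def)
  have mean: "(\<Sum>i=1..n. weight n L i *\<^sub>R (\<xi> i - m)) = 0"
    using estimate_unbiased[OF x0 u] sum_weight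
    by (simp add: scaleR_diff_right sum_subtractf flip: est scaleR_sum_left)
  \<comment> \<open>The second moment dominates the variance.\<close>
  have "(\<Sum>i=1..n. weight n L i * (norm (\<xi> i - m))\<^sup>2)
      = (\<Sum>i=1..n. weight n L i * (norm (\<xi> i))\<^sup>2) - (norm m)\<^sup>2
        - 2 * inner (\<Sum>i=1..n. weight n L i *\<^sub>R (\<xi> i - m)) m"
  proof -
    have "weight n L i * (norm (\<xi> i - m))\<^sup>2 = weight n L i * (norm (\<xi> i))\<^sup>2
        - weight n L i * (norm m)\<^sup>2 - 2 * inner (weight n L i *\<^sub>R (\<xi> i - m)) m" for i
      unfolding power2_norm_eq_inner
      by (simp add: inner_diff_left inner_diff_right inner_commute algebra_simps)
    then have "(\<Sum>i=1..n. weight n L i * (norm (\<xi> i - m))\<^sup>2)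
        = (\<Sum>i=1..n. weight n L i * (norm (\<xi> i))\<^sup>2) - (\<Sum>i=1..n. weight n L i) * (norm m)\<^sup>2
          - 2 * (\<Sum>i=1..n. inner (weight n L i *\<^sub>R (\<xi> i - m)) m)"
      by (simp only: sum_subtractf sum_distrib_left sum_distrib_right)
    then show ?thesis using sum_weight by (simp only: inner_sum_left mult_1)
  qed
  then have "(\<Sum>i=1..n. weight n L i * (norm (\<xi> i - m))\<^sup>2)
      \<le> (\<Sum>i=1..n. weight n L i * (norm (\<xi> i))\<^sup>2)"
    using mean by simp
  also have "\<dots> \<le> (\<Sum>i=1..n. Lb / real n * (6 * bregman E (f i) xs u + 3 * bregman E (f i) x0 xs))"
  proof (rule sum_mono)
    fix i assume i: "i \<in> {1..n}"
    let ?a = "grad E (f i) xs - grad E (f i) u" and ?b = "grad E (f i) x0 - grad E (f i) xs"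
    have "(norm (grad E (f i) u - grad E (f i) x0))\<^sup>2 = (norm (?a + ?b))\<^sup>2"
      by (simp add: norm_minus_commute)
    also have "\<dots> \<le> 3 * (norm ?a)\<^sup>2 + 3 / 2 * (norm ?b)\<^sup>2"
    proof -
      have "0 \<le> (norm (2 *\<^sub>R ?a - ?b))\<^sup>2 / 2" by simp
      also have "\<dots> = 3 * (norm ?a)\<^sup>2 + 3 / 2 * (norm ?b)\<^sup>2 - (norm (?a + ?b))\<^sup>2"
        unfolding power2_norm_eq_inner
        by (simp add: inner_add_left inner_add_right inner_diff_left inner_diff_right inner_commute)
      finally show ?thesis by simp
    qed
    also have "\<dots> \<le> 3 * (2 * L i * bregman E (f i) xs u) + 3 / 2 * (2 * L i * bregman E (f i) x0 xs)"
      using i xs u x0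
      by (intro add_mono mult_left_mono cocoercive f_convex f_diff f_lipschitz L_pos) auto
    finally have le: "(norm (grad E (f i) u - grad E (f i) x0))\<^sup>2
        \<le> L i * (6 * bregman E (f i) xs u + 3 * bregman E (f i) x0 xs)"
      by (simp add: algebra_simps)
    have nw: "real n * weight n L i = L i / Lb"
      using n_pos by (simp add: weight_def)
    have "weight n L i * (norm (\<xi> i))\<^sup>2
        = Lb / real n / L i * (norm (grad E (f i) u - grad E (f i) x0))\<^sup>2"
      unfolding \<xi>_def nw norm_scaleR power_mult_distrib using n_pos L_pos[OF i] Lb_pos
      by (simp add: weight_def power2_eq_square)
    also have "\<dots> \<le> Lb / real n / L i * (L i * (6 * bregman E (f i) xs u + 3 * bregman E (f i) x0 xs))"
      using le L_pos[OF i] Lb_pos by (intro mult_left_mono) auto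
    also have "\<dots> = Lb / real n * (6 * bregman E (f i) xs u + 3 * bregman E (f i) x0 xs)"
      using L_pos[OF i] by simp
    finally show "weight n L i * (norm (\<xi> i))\<^sup>2
        \<le> Lb / real n * (6 * bregman E (f i) xs u + 3 * bregman E (f i) x0 xs)" .
  qed
  also have "\<dots> = Lb * (6 * bregman E F xs u + 3 * bregman E F x0 xs)"
    using xs u by (simp add: bregman_F sum.distrib sum_distrib_left algebra_simps)
  finally show ?thesis by (simp add: est)
qed

section \<open>One inner iteration\<close>

text \<open>
  Up to the factor \<open>t\<close>, this is the objective that \<open>v\<^sub>t\<close> minimises; unlike that objective it makes
  sense for \<open>t = 0\<close>, where its minimiser is \<open>v0\<close>.
\<close>

definition dual_model :: "'a \<Rightarrow> nat \<Rightarrow> 'a \<Rightarrow> 'a \<Rightarrow> real" where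
  "dual_model v0 t gbar z = real t * (inner gbar z + R z) + 2 * Lb * (norm (z - v0))\<^sup>2"

text \<open>
  The last conjunct expresses that \<open>v\<close> minimises the dual model, in the quantitative form in which
  this fact is used. The formula for \<open>u\<close> also covers the start, where the weight of \<open>x\<close> is zero.
\<close>

fun inner_inv :: "'a \<Rightarrow> nat \<Rightarrow> 'a \<times> 'a \<times> 'a \<times> 'a \<Rightarrow> bool" where
  "inner_inv v0 t (gbar, x, v, u) \<longleftrightarrow> x \<in> E \<and> v \<in> E
     \<and> u = (1 - 1 / (real t + 1)) *\<^sub>R x + (1 / (real t + 1)) *\<^sub>R v
     \<and> (\<forall>z\<in>E. dual_model v0 t gbar v + 2 * Lb * (norm (z - v))\<^sup>2 \<le> dual_model v0 t gbar z)"

text \<open>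
  The second summand compares the dual model at the minimiser of the problem with its minimum. Since
  the averaged gradient is part of the state, the whole history of linearisations is available and
  the analysis reduces to the increment of this function over a single iteration.
\<close>

fun potential :: "'a \<Rightarrow> nat \<Rightarrow> 'a \<times> 'a \<times> 'a \<times> 'a \<Rightarrow> real" where
  "potential v0 t (gbar, x, v, u) =
     real t * (P x - P xs) + (dual_model v0 t gbar xs - dual_model v0 t gbar v)"

lemma inner_inv_0: "v0 \<in> E \<Longrightarrow> x0 \<in> E \<Longrightarrow> inner_inv v0 0 (0, x0, v0, v0)"
  by (simp add: dual_model_def)

lemma dual_model_Suc:
  assumes "gbar' = (1 - 1 / real (Suc t)) *\<^sub>R gbar + (1 / real (Suc t)) *\<^sub>R g"
  shows "dual_model v0 (Suc t) gbar' z = dual_model v0 t gbar z + inner g z + R z"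
proof -
  have "real (Suc t) * inner gbar' z
      = real (Suc t) * (1 - 1 / real (Suc t)) * inner gbar z + inner g z"
    unfolding assms inner_add_left inner_scaleR_left by (simp add: distrib_left)
  also have "real (Suc t) * (1 - 1 / real (Suc t)) = real t" by (simp add: field_simps)
  finally show ?thesis by (simp add: dual_model_def distrib_left algebra_simps)
qed

text \<open>
  Three inequalities carry the estimate. Smoothness bounds \<open>F\<close> at the new \<open>x\<close> by its linearisation
  at \<open>u\<close>. Optimality of the primal step lets the new \<open>x\<close> be replaced by the combination of the old
  \<open>x\<close> and the new \<open>v\<close>, at the price of the squared length of the dual step; growth of the dual
  model around the old \<open>v\<close> refunds that price. What remains is the error \<open>e\<close> of the gradient
  estimate, linearly and squared.
\<close>

lemma svrda_step_potential:
  fixes i :: nat and x0 :: 'a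
  assumes inv: "inner_inv v0 t (gbar, x, v, u)" and v0: "v0 \<in> E"
  defines "e \<equiv> estimate x0 u i - grad E F u"
  defines "st \<equiv> svrda_step E n f L R (4 * Lb) x0 v0 (Suc t) i (gbar, x, v, u)"
  shows "inner_inv v0 (Suc t) st"
    and "potential v0 (Suc t) st \<le> potential v0 t (gbar, x, v, u)
      + inner e (real t *\<^sub>R (x - u) + (xs - u)) - bregman E F xs u + (norm e)\<^sup>2 / (6 * Lb)"
proof -
  define a where "a = real (Suc t)"
  have a: "a \<ge> 1" "real t = a - 1" by (auto simp: a_def)
  define g where "g = estimate x0 u i"
  define gbar' where "gbar' = (1 - 1 / a) *\<^sub>R gbar + (1 / a) *\<^sub>R g"
  define v' where "v' = arg_min_on (\<lambda>z. inner gbar' z + R z + 4 * Lb / (2 * a) * (norm (z - v0))\<^sup>2) E"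
  define x' where "x' = arg_min_on (\<lambda>z. inner g z + R z + 4 * Lb * a / 2 * (norm (z - u))\<^sup>2) E"
  define u' where "u' = (1 - 1 / (a + 1)) *\<^sub>R x' + (1 / (a + 1)) *\<^sub>R v'"
  have st: "st = (gbar', x', v', u')"
    unfolding st_def svrda_step.simps Let_def estimate_def[symmetric] a_def[symmetric] g_def[symmetric]
      gbar'_def[symmetric] v'_def[symmetric] x'_def[symmetric] u'_def[symmetric] ..
  have x: "x \<in> E" and v: "v \<in> E" and u_eq: "u = (1 - 1 / a) *\<^sub>R x + (1 / a) *\<^sub>R v"
    and v_growth: "\<And>z. z \<in> E \<Longrightarrow>
      dual_model v0 t gbar v + 2 * Lb * (norm (z - v))\<^sup>2 \<le> dual_model v0 t gbar z"
    using inv by (auto simp: a_def add.commute)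
  have u: "u \<in> E" unfolding u_eq using x v by (intro E_intros)
  have model: "dual_model v0 (Suc t) gbar' z = dual_model v0 t gbar z + inner g z + R z" for z
    by (rule dual_model_Suc) (simp add: gbar'_def a_def)

  have c: "4 * Lb / (2 * a) > 0" "4 * Lb * a / 2 > 0" using Lb_pos a by auto
  have v': "v' \<in> E" unfolding v'_def by (rule prox_growth(1)[OF R_convex v0 c(1) xs])
  have x': "x' \<in> E" unfolding x'_def by (rule prox_growth(1)[OF R_convex u c(2) xs])
  have v'_growth: "dual_model v0 (Suc t) gbar' v' + 2 * Lb * (norm (z - v'))\<^sup>2
      \<le> dual_model v0 (Suc t) gbar' z" if z: "z \<in> E" for z
  proof -
    have scale: "a * (4 * Lb / (2 * a) * r) = 2 * Lb * r" for r using a by simp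
    have "a * (inner gbar' v' + R v' + 4 * Lb / (2 * a) * (norm (v' - v0))\<^sup>2
          + 4 * Lb / (2 * a) * (norm (z - v'))\<^sup>2)
        \<le> a * (inner gbar' z + R z + 4 * Lb / (2 * a) * (norm (z - v0))\<^sup>2)"
      using prox_growth(2)[OF R_convex v0 c(1) z, of gbar'] a unfolding v'_def[symmetric]
      by (intro mult_left_mono) auto
    then show ?thesis
      unfolding dual_model_def a_def[symmetric] distrib_left[of a "_ + _"] scale .
  qed
  show "inner_inv v0 (Suc t) st"
    using x' v' v'_growth by (simp add: st u'_def a_def)

  \<comment> \<open>The primal step is compared with \<open>y\<close>, which differs from \<open>u\<close> by a fraction of the dual step.\<close>
  define y where "y = (1 - 1 / a) *\<^sub>R x + (1 / a) *\<^sub>R v'"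
  have y: "y \<in> E" unfolding y_def using x v' by (intro E_intros)
  define D where "D = Lb * (a\<^sup>2 * (norm (x' - u))\<^sup>2)"
  define V where "V = Lb * (norm (v' - v))\<^sup>2"
  have x'_le: "a * inner g x' + a * R x' + 2 * D
      \<le> real t * inner g x + inner g v' + real t * R x + R v' + 2 * V"
  proof -
    have "a * (inner g x' + R x' + 4 * Lb * a / 2 * (norm (x' - u))\<^sup>2)
        \<le> a * (inner g y + R y + 4 * Lb * a / 2 * (norm (y - u))\<^sup>2)"
    proof (rule mult_left_mono)
      have "0 \<le> 4 * Lb * a / 2 * (norm (y - x'))\<^sup>2" using c(2) by simp
      then show "inner g x' + R x' + 4 * Lb * a / 2 * (norm (x' - u))\<^sup>2
          \<le> inner g y + R y + 4 * Lb * a / 2 * (norm (y - u))\<^sup>2"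
        using prox_growth(2)[OF R_convex u c(2) y, of g] unfolding x'_def[symmetric] by linarith
    qed (use a in simp)
    moreover have "a * inner g y = real t * inner g x + inner g v'"
    proof -
      have "a * inner g y = (a * (1 - 1 / a)) * inner g x + (a * (1 / a)) * inner g v'"
        unfolding y_def by (simp add: inner_add_right distrib_left)
      also have "a * (1 - 1 / a) = real t" using a by (simp add: right_diff_distrib)
      finally show ?thesis using a by simp
    qed
    moreover have "a * R y \<le> real t * R x + R v'"
    proof -
      have "a * R y \<le> a * ((1 - 1 / a) * R x + (1 / a) * R v')"
        unfolding y_def using a x v' by (intro mult_left_mono convex_onD[OF R_convex]) auto
      also have "\<dots> = (a * (1 - 1 / a)) * R x + (a * (1 / a)) * R v'" by (simp add: distrib_left)
      also have "a * (1 - 1 / a) = real t" using a by (simp add: right_diff_distrib)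
      finally show ?thesis using a by simp
    qed
    moreover have "a * (4 * Lb * a / 2 * (norm (y - u))\<^sup>2) = 2 * V"
    proof -
      have "y - u = (1 / a) *\<^sub>R (v' - v)" by (simp add: y_def u_eq algebra_simps)
      then show ?thesis using a by (simp add: V_def power_mult_distrib power2_eq_square)
    qed
    moreover have "a * (4 * Lb * a / 2 * (norm (x' - u))\<^sup>2) = 2 * D"
      by (simp add: D_def power2_eq_square)
    ultimately show ?thesis by (simp add: distrib_left)
  qed
  have Fx': "a * F x' \<le> a * F u + a * inner (grad E F u) (x' - u) + D / 2"
  proof -
    have "F x' \<le> F u + inner (grad E F u) (x' - u) + Lb / 2 * (norm (x' - u))\<^sup>2"
      using bregman_F_le[OF u x'] by (simp add: bregman_def)
    then have "a * F x' \<le> a * (F u + inner (grad E F u) (x' - u) + Lb / 2 * (norm (x' - u))\<^sup>2)"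
      using a by (intro mult_left_mono) auto
    moreover have "a * (Lb / 2 * (norm (x' - u))\<^sup>2) \<le> D / 2"
    proof -
      have "a * (Lb / 2 * (norm (x' - u))\<^sup>2) \<le> a\<^sup>2 * (Lb / 2 * (norm (x' - u))\<^sup>2)"
        using a Lb_pos by (intro mult_right_mono) (auto simp: power2_eq_square)
      also have "\<dots> = D / 2" by (simp add: D_def)
      finally show ?thesis .
    qed
    ultimately show ?thesis unfolding distrib_left by linarith
  qed
  \<comment> \<open>The quadratic slack of the primal step pays for the error of the estimate.\<close>
  have young: "- (a * inner e (x' - u)) - 3 / 2 * D \<le> (norm e)\<^sup>2 / (6 * Lb)"
  proof -
    have "0 \<le> (norm (e + (3 * Lb * a) *\<^sub>R (x' - u)))\<^sup>2 / (6 * Lb)" using Lb_pos by simp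
    also have "(norm (e + (3 * Lb * a) *\<^sub>R (x' - u)))\<^sup>2
        = (norm e)\<^sup>2 + 6 * Lb * (a * inner e (x' - u) + 3 / 2 * D)"
      unfolding D_def power2_norm_eq_inner
      by (simp add: inner_add_left inner_add_right inner_commute power2_eq_square algebra_simps)
    also have "\<dots> / (6 * Lb) = (norm e)\<^sup>2 / (6 * Lb) + (a * inner e (x' - u) + 3 / 2 * D)"
      using Lb_pos by (simp add: add_divide_distrib)
    finally show ?thesis by simp
  qed
  have Fx: "0 \<le> real t * (F x - F u - inner (grad E F u) (x - u))"
    using bregman_nonneg[OF F_convex F_diff u x] by (simp add: bregman_def)
  have split: "inner g z = inner (grad E F u) z + inner e z" for z
    by (simp add: e_def g_def inner_diff_left)
  have "dual_model v0 t gbar v + 2 * V \<le> dual_model v0 t gbar v'"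
    using v_growth[OF v'] by (simp add: V_def)
  then have "potential v0 (Suc t) st - potential v0 t (gbar, x, v, u)
      \<le> a * (F x' + R x' - P xs) - real t * (F x + R x - P xs)
        + inner g xs + R xs - inner g v' - R v' - 2 * V"
    unfolding st potential.simps model a_def[symmetric] by (simp add: objective_def)
  also have "\<dots> \<le> inner e (real t *\<^sub>R (x - u) + (xs - u)) - bregman E F xs u + (norm e)\<^sup>2 / (6 * Lb)"
    using x'_le Fx' young Fx
    unfolding bregman_def objective_def a(2) split inner_add_right inner_diff_right inner_scaleR_right
    by (simp add: algebra_simps)
  finally show "potential v0 (Suc t) st \<le> potential v0 t (gbar, x, v, u)
      + inner e (real t *\<^sub>R (x - u) + (xs - u)) - bregman E F xs u + (norm e)\<^sup>2 / (6 * Lb)"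
    by simp
qed

text \<open>
  On average the linear error term vanishes and the variance bound cancels the Bregman distance
  gained from the convexity of \<open>F\<close>.
\<close>

lemma expected_step_potential:
  assumes inv: "inner_inv v0 t st" and v0: "v0 \<in> E" and x0: "x0 \<in> E"
  shows "measure_pmf.expectation (Q n L)
      (\<lambda>i. potential v0 (Suc t) (svrda_step E n f L R (4 * Lb) x0 v0 (Suc t) i st))
    \<le> potential v0 t st + (P x0 - P xs) / 2"
proof -
  obtain gbar x v u where st: "st = (gbar, x, v, u)" by (cases st)
  have inv': "inner_inv v0 t (gbar, x, v, u)" using inv by (simp add: st)
  have u: "u \<in> E" using inv' by (auto intro!: E_intros)
  define w where "w = real t *\<^sub>R (x - u) + (xs - u)"
  define e where "e i = estimate x0 u i - grad E F u" for i
  define c where "c = potential v0 t st - bregman E F xs u"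
  have "measure_pmf.expectation (Q n L)
      (\<lambda>i. potential v0 (Suc t) (svrda_step E n f L R (4 * Lb) x0 v0 (Suc t) i st))
    \<le> (\<Sum>i=1..n. weight n L i * (c + inner (e i) w + (norm (e i))\<^sup>2 / (6 * Lb)))"
    unfolding expectation_Q
  proof (intro sum_mono mult_left_mono)
    fix i
    show "potential v0 (Suc t) (svrda_step E n f L R (4 * Lb) x0 v0 (Suc t) i st)
        \<le> c + inner (e i) w + (norm (e i))\<^sup>2 / (6 * Lb)"
      using svrda_step_potential(2)[OF inv' v0, of x0 i] by (simp add: st c_def e_def w_def)
  qed (use weight_pos less_imp_le in blast)
  also have "\<dots> = (\<Sum>i=1..n. weight n L i) * c + inner (\<Sum>i=1..n. weight n L i *\<^sub>R e i) w
      + (\<Sum>i=1..n. weight n L i * (norm (e i))\<^sup>2) / (6 * Lb)"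
    by (simp add: distrib_left sum.distrib sum_distrib_right inner_sum_left sum_divide_distrib)
  also have "(\<Sum>i=1..n. weight n L i *\<^sub>R e i) = 0"
    using estimate_unbiased[OF x0 u] sum_weight
    by (simp add: e_def scaleR_diff_right sum_subtractf flip: scaleR_sum_left)
  also have "(\<Sum>i=1..n. weight n L i * (norm (e i))\<^sup>2) / (6 * Lb)
      \<le> Lb * (6 * bregman E F xs u + 3 * bregman E F x0 xs) / (6 * Lb)"
    using estimate_variance[OF x0 u] Lb_pos unfolding e_def by (intro divide_right_mono) auto
  also have "\<dots> = bregman E F xs u + bregman E F x0 xs / 2"
    using Lb_pos by (simp add: field_simps)
  also have "bregman E F x0 xs \<le> P x0 - P xs" using x0 by (rule bregman_F_minimizer_le)
  finally show ?thesis using sum_weight by (simp add: c_def)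
qed

end

section \<open>From one iteration to all stages\<close>

lemma expectation_bind_le:
  fixes h :: "'b \<Rightarrow> real"
  assumes p: "finite (set_pmf p)" and k: "\<And>x. x \<in> set_pmf p \<Longrightarrow> finite (set_pmf (k x))"
    and le: "\<And>x. x \<in> set_pmf p \<Longrightarrow> measure_pmf.expectation (k x) h \<le> b x"
  shows "measure_pmf.expectation (p \<bind> k) h \<le> measure_pmf.expectation p b"
proof -
  have "measure_pmf.expectation (p \<bind> k) h
      = (\<Sum>x\<in>set_pmf p. pmf p x *\<^sub>R measure_pmf.expectation (k x) h)"
    using p k by (intro pmf_expectation_bind) auto
  also have "\<dots> \<le> (\<Sum>x\<in>set_pmf p. b x * pmf p x)"
    using le by (intro sum_mono) (simp add: mult.commute[of "b _"] mult_left_mono)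
  also have "\<dots> = measure_pmf.expectation p b"
    using p by (intro integral_measure_pmf_real[symmetric]) auto
  finally show ?thesis .
qed

lemma expectation_mono_finite:
  fixes h b :: "'b \<Rightarrow> real"
  assumes p: "finite (set_pmf p)" and le: "\<And>x. x \<in> set_pmf p \<Longrightarrow> h x \<le> b x"
  shows "measure_pmf.expectation p h \<le> measure_pmf.expectation p b"
  by (intro integral_mono_AE integrable_measure_pmf_finite p) (auto simp: AE_measure_pmf_iff le)

context finite_sum_problem
begin

lemma svrda_inner_potential:
  assumes v0: "v0 \<in> E" and x0: "x0 \<in> E"
  defines "law \<equiv> svrda_inner E n f L R (4 * Lb) x0 v0"
  shows "finite (set_pmf (law t)) \<and> (\<forall>st\<in>set_pmf (law t). inner_inv v0 t st) \<and>
    measure_pmf.expectation (law t) (potential v0 t)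
      \<le> 2 * Lb * (norm (xs - v0))\<^sup>2 + real t * ((P x0 - P xs) / 2)"
proof (induction t)
  case 0
  then show ?case
    using inner_inv_0[OF v0 x0] by (simp add: law_def dual_model_def)
next
  case (Suc t)
  define \<Delta> where "\<Delta> = (P x0 - P xs) / 2"
  let ?next = "\<lambda>st. Q n L \<bind> (\<lambda>i. return_pmf (svrda_step E n f L R (4 * Lb) x0 v0 (Suc t) i st))"
  have law: "law (Suc t) = law t \<bind> ?next" by (simp add: law_def)
  have next_map: "?next st = map_pmf (\<lambda>i. svrda_step E n f L R (4 * Lb) x0 v0 (Suc t) i st) (Q n L)" for st
    by (simp only: map_pmf_def)
  have fin_next: "finite (set_pmf (?next st))" for st
    unfolding next_map using finite_subset[OF set_Q] by simp
  have inv: "inner_inv v0 (Suc t) st'" if "st \<in> set_pmf (law t)" "st' \<in> set_pmf (?next st)" for st st'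
  proof -
    obtain gbar x v u where "st = (gbar, x, v, u)" by (cases st)
    then show ?thesis
      using svrda_step_potential(1)[OF _ v0] Suc that unfolding next_map by auto
  qed
  have "measure_pmf.expectation (law (Suc t)) (potential v0 (Suc t))
      \<le> measure_pmf.expectation (law t) (\<lambda>st. potential v0 t st + \<Delta>)"
    unfolding law
  proof (rule expectation_bind_le)
    fix st assume "st \<in> set_pmf (law t)"
    then have "inner_inv v0 t st" using Suc by blast
    then show "measure_pmf.expectation (?next st) (potential v0 (Suc t)) \<le> potential v0 t st + \<Delta>"
      unfolding next_map integral_map_pmf \<Delta>_def using v0 x0 by (rule expected_step_potential)
  qed (use Suc fin_next in auto)
  also have "\<dots> = measure_pmf.expectation (law t) (potential v0 t) + \<Delta>"
    using Suc by (simp add: integrable_measure_pmf_finite)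
  also have "\<dots> \<le> 2 * Lb * (norm (xs - v0))\<^sup>2 + real (Suc t) * \<Delta>"
    using Suc unfolding \<Delta>_def[symmetric] by (simp add: distrib_right)
  finally show ?case
    using Suc fin_next inv unfolding law \<Delta>_def by auto
qed

text \<open>
  The weight of the distance term is inversely proportional to the length \<open>2 ^ s * m1\<close> of the
  stage that is about to begin. Doubling the stage length therefore turns the distance term left
  over by a stage into exactly half of the one that it started with.
\<close>

fun stage_potential :: "nat \<Rightarrow> nat \<Rightarrow> 'a \<times> 'a \<Rightarrow> real" where
  "stage_potential m1 s (x, v) = P x - P xs + 4 * Lb / (2 ^ s * real m1) * (norm (v - xs))\<^sup>2"

text \<open>
  At the end of a stage of length \<open>m\<close> the inner potential is at least \<open>m\<close> times the gap plus the
  growth of the dual model, so dividing the accumulated bound by \<open>m\<close> gives the claim.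
\<close>

lemma stage_contraction:
  fixes s :: nat
  assumes v0: "v0 \<in> E" and x0: "x0 \<in> E" and m1: "m1 \<ge> 1"
  defines "law \<equiv> svrda_inner E n f L R (4 * Lb) x0 v0 (stage_length m1 (Suc s))"
  shows "measure_pmf.expectation law (\<lambda>(gbar, x, v, u). stage_potential m1 (Suc s) (x, v))
    \<le> stage_potential m1 s (x0, v0) / 2"
proof -
  define m where "m = stage_length m1 (Suc s)"
  have m: "m \<ge> 1" "real m = 2 ^ s * real m1" using m1 by (simp_all add: m_def stage_length_def)
  have fin: "finite (set_pmf law)" and inv: "\<And>st. st \<in> set_pmf law \<Longrightarrow> inner_inv v0 m st"
    and bound: "measure_pmf.expectation law (potential v0 m)
      \<le> 2 * Lb * (norm (xs - v0))\<^sup>2 + real m * ((P x0 - P xs) / 2)"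
    using svrda_inner_potential[OF v0 x0, of m] unfolding law_def m_def by auto
  have "measure_pmf.expectation law (\<lambda>(gbar, x, v, u). stage_potential m1 (Suc s) (x, v))
      \<le> measure_pmf.expectation law (\<lambda>st. potential v0 m st / real m)"
  proof (intro expectation_mono_finite fin)
    fix st assume "st \<in> set_pmf law"
    then have inv_st: "inner_inv v0 m st" by (rule inv)
    obtain gbar x v u where st: "st = (gbar, x, v, u)" by (cases st)
    have "2 * Lb * (norm (xs - v))\<^sup>2 \<le> dual_model v0 m gbar xs - dual_model v0 m gbar v"
      using inv_st xs unfolding st inner_inv.simps by force
    then have "real m * (P x - P xs) + 2 * Lb * (norm (v - xs))\<^sup>2 \<le> potential v0 m st"
      by (simp add: st norm_minus_commute)
    then have "(real m * (P x - P xs) + 2 * Lb * (norm (v - xs))\<^sup>2) / real m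
        \<le> potential v0 m st / real m"
      by (rule divide_right_mono) simp
    moreover have "(real m * (P x - P xs) + 2 * Lb * (norm (v - xs))\<^sup>2) / real m
        = stage_potential m1 (Suc s) (x, v)"
      using m m1 by (simp add: add_divide_distrib)
    ultimately show "(case st of (gbar, x, v, u) \<Rightarrow> stage_potential m1 (Suc s) (x, v))
        \<le> potential v0 m st / real m"
      by (simp add: st)
  qed
  also have "\<dots> = measure_pmf.expectation law (potential v0 m) / real m" by simp
  also have "\<dots> \<le> (2 * Lb * (norm (xs - v0))\<^sup>2 + real m * ((P x0 - P xs) / 2)) / real m"
    using bound by (rule divide_right_mono) simp
  also have "\<dots> = stage_potential m1 s (x0, v0) / 2"
    using m m1 by (simp add: add_divide_distrib norm_minus_commute mult.assoc mult.commute[of "2 ^ s"])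
  finally show ?thesis .
qed

lemma svrda_potential:
  assumes xinit: "xinit \<in> E" and m1: "m1 \<ge> 1"
  defines "law \<equiv> svrda E n f L R (4 * Lb) m1 0 xinit"
  shows "finite (set_pmf (law s)) \<and> set_pmf (law s) \<subseteq> E \<times> E \<and>
    measure_pmf.expectation (law s) (stage_potential m1 s) \<le> initial_bound n f L R m1 xinit xs / 2 ^ s"
proof (induction s)
  case 0
  then show ?case
    using xinit by (simp add: law_def initial_bound_def)
next
  case (Suc s)
  define stage where "stage = (\<lambda>(x, v). map_pmf (\<lambda>(gbar, x', v', u). (x', v'))
    (svrda_inner E n f L R (4 * Lb) x v (stage_length m1 (Suc s))))"
  have law: "law (Suc s) = law s \<bind> stage"
    by (simp add: law_def stage_def map_pmf_def case_prod_unfold)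
  have stage: "finite (set_pmf (stage xv)) \<and> set_pmf (stage xv) \<subseteq> E \<times> E"
    if "xv \<in> set_pmf (law s)" for xv
  proof -
    obtain x v where xv: "xv = (x, v)" by (cases xv)
    then have "x \<in> E" "v \<in> E" using that Suc by auto
    then show ?thesis
      using svrda_inner_potential[of v x "stage_length m1 (Suc s)"] unfolding xv stage_def by fastforce
  qed
  have "measure_pmf.expectation (law (Suc s)) (stage_potential m1 (Suc s))
      \<le> measure_pmf.expectation (law s) (\<lambda>xv. stage_potential m1 s xv / 2)"
    unfolding law
  proof (rule expectation_bind_le)
    fix xv assume xv: "xv \<in> set_pmf (law s)"
    obtain x v where xv_eq: "xv = (x, v)" by (cases xv)
    then have "x \<in> E" "v \<in> E" using xv Suc by auto
    from stage_contraction[OF this(2,1) m1, of s]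
    show "measure_pmf.expectation (stage xv) (stage_potential m1 (Suc s)) \<le> stage_potential m1 s xv / 2"
      unfolding xv_eq stage_def by (simp add: integral_map_pmf case_prod_unfold)
  qed (use Suc stage in auto)
  also have "\<dots> = measure_pmf.expectation (law s) (stage_potential m1 s) / 2" by simp
  also have "\<dots> \<le> initial_bound n f L R m1 xinit xs / 2 ^ Suc s" using Suc by simp
  finally show ?case using Suc stage unfolding law by (auto dest!: stage)
qed

lemma expected_gap_le:
  assumes xinit: "xinit \<in> E" and m1: "m1 \<ge> 1"
  shows "expected_gap E n f L R (4 * Lb) m1 0 xinit xs S \<le> initial_bound n f L R m1 xinit xs / 2 ^ S"
proof -
  let ?law = "svrda E n f L R (4 * Lb) m1 0 xinit S"
  have "expected_gap E n f L R (4 * Lb) m1 0 xinit xs S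
      \<le> measure_pmf.expectation ?law (stage_potential m1 S)"
    unfolding expected_gap_def
    using svrda_potential[OF xinit m1, of S] Lb_pos
    by (intro expectation_mono_finite) auto
  also have "\<dots> \<le> initial_bound n f L R m1 xinit xs / 2 ^ S"
    using svrda_potential[OF xinit m1, of S] by blast
  finally show ?thesis .
qed

lemma initial_bound_nonneg: "xinit \<in> E \<Longrightarrow> initial_bound n f L R m1 xinit xs \<ge> 0"
  using Lb_pos gap_nonneg[of xinit] by (simp add: initial_bound_def)

end

section \<open>The gradient complexity\<close>

lemma grad_evals_eq: "real (grad_evals n m1 S) = real n * real S + 2 * real m1 * (2 ^ S - 1)"
proof (induction S)
  case (Suc S)
  have "grad_evals n m1 (Suc S) = grad_evals n m1 S + (n + 2 * stage_length m1 (Suc S))"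
    by (simp add: grad_evals_def)
  then show ?case using Suc by (simp add: stage_length_def algebra_simps)
qed (simp add: grad_evals_def)

text \<open>The least admissible number of stages overshoots the target by a factor of at most two.\<close>

lemma few_stages_suffice:
  fixes D \<epsilon> :: real
  assumes D: "D \<ge> 0" and \<epsilon>: "0 < \<epsilon>" "\<epsilon> \<le> 1 / 2"
  obtains S where "S \<ge> 1" "D / 2 ^ S \<le> \<epsilon>" "2 ^ S \<le> (1 + 2 * D) / \<epsilon>"
proof -
  define ok where "ok S \<longleftrightarrow> S \<ge> 1 \<and> D / \<epsilon> \<le> 2 ^ S" for S :: nat
  obtain k where "D / \<epsilon> < 2 ^ k" using real_arch_pow[of 2 "D / \<epsilon>"] by auto
  also have "(2::real) ^ k \<le> 2 ^ Suc k" by simp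
  finally have "ok (Suc k)" by (simp add: ok_def)
  define S where "S = (LEAST S. ok S)"
  have S: "ok S" unfolding S_def using \<open>ok (Suc k)\<close> by (rule LeastI)
  have "2 ^ S \<le> (1 + 2 * D) / \<epsilon>"
  proof (cases "S = 1")
    case True
    then show ?thesis using D \<epsilon> by (simp add: field_simps)
  next
    case False
    then have "S - 1 \<ge> 1" using S by (auto simp: ok_def)
    moreover have "\<not> ok (S - 1)" using not_less_Least[of "S - 1" ok] \<open>S - 1 \<ge> 1\<close> by (simp add: S_def)
    ultimately have "2 ^ (S - 1) < D / \<epsilon>" by (simp add: ok_def)
    moreover have "(2::real) ^ S = 2 * 2 ^ (S - 1)" using S by (cases S) (auto simp: ok_def)
    ultimately have "2 ^ S \<le> 2 * D / \<epsilon>" by simp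
    also have "\<dots> \<le> (1 + 2 * D) / \<epsilon>" using \<epsilon> by (intro divide_right_mono) auto
    finally show ?thesis .
  qed
  then show ?thesis using that S \<epsilon> by (auto simp: ok_def field_simps)
qed

text \<open>
  The first summand bounds the number of stages relative to \<open>ln (1 / \<epsilon>)\<close>, using
  \<open>ln 2 \<le> ln (1 / \<epsilon>)\<close> to absorb the additive term \<open>ln (1 + 2 * D)\<close>. The second one bounds the
  number of inner iterations, which is dominated by the last stages.
\<close>

definition complexity_constant :: "real \<Rightarrow> real \<Rightarrow> real" where
  "complexity_constant c D = (ln (1 + 2 * D) / ln 2 + 1) / ln 2 + 2 * c * (1 + 2 * D)"

lemma grad_evals_le:
  assumes D: "D \<ge> 0" and \<epsilon>: "0 < \<epsilon>" "\<epsilon> \<le> 1 / 2"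
    and S: "2 ^ S \<le> (1 + 2 * D) / \<epsilon>"
    and m1: "real m1 \<le> c * l" and l: "l > 0" and c: "c \<ge> 0"
  shows "real (grad_evals n m1 S) \<le> complexity_constant c D * (real n * ln (1 / \<epsilon>) + l / \<epsilon>)"
proof -
  define A where "A = (ln (1 + 2 * D) / ln 2 + 1) / ln 2"
  define C where "C = 2 * c * (1 + 2 * D)"
  have A: "A \<ge> 0" and C: "C \<ge> 0" using D c by (auto simp: A_def C_def)
  have ln_\<epsilon>: "ln 2 \<le> ln (1 / \<epsilon>)"
    using \<epsilon> by (subst ln_le_cancel_iff) (auto simp: field_simps)
  have "real S * ln 2 = ln (2 ^ S)" by (simp add: ln_realpow)
  also have "\<dots> \<le> ln ((1 + 2 * D) * (1 / \<epsilon>))" using S D \<epsilon> by (subst ln_le_cancel_iff) auto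
  also have "\<dots> = ln (1 + 2 * D) + ln (1 / \<epsilon>)" using D \<epsilon> by (intro ln_mult_pos) auto
  also have "ln (1 + 2 * D) \<le> ln (1 + 2 * D) / ln 2 * ln (1 / \<epsilon>)"
  proof -
    have "ln (1 + 2 * D) / ln 2 * ln 2 \<le> ln (1 + 2 * D) / ln 2 * ln (1 / \<epsilon>)"
      using ln_\<epsilon> D by (intro mult_left_mono) auto
    then show ?thesis by simp
  qed
  finally have "real S \<le> A * ln (1 / \<epsilon>)" by (simp add: A_def field_simps)
  then have "real n * real S \<le> A * (real n * ln (1 / \<epsilon>))"
    using mult_left_mono[of "real S" "A * ln (1 / \<epsilon>)" "real n"] by (simp add: mult.left_commute)
  moreover have "2 * real m1 * (2 ^ S - 1) \<le> C * (l / \<epsilon>)"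
  proof -
    have "2 * real m1 * (2 ^ S - 1) \<le> 2 * (c * l) * ((1 + 2 * D) / \<epsilon>)"
      using S m1 c l by (intro mult_mono) auto
    also have "\<dots> = C * (l / \<epsilon>)" by (simp add: C_def)
    finally show ?thesis .
  qed
  moreover have "0 \<le> A * (l / \<epsilon>)" using A l \<epsilon> by simp
  moreover have "0 \<le> C * (real n * ln (1 / \<epsilon>))"
    using C \<epsilon> by (intro mult_nonneg_nonneg) auto
  moreover have const: "complexity_constant c D = A + C"
    by (simp add: complexity_constant_def A_def C_def)
  moreover have "complexity_constant c D * (real n * ln (1 / \<epsilon>) + l / \<epsilon>)
      = A * (real n * ln (1 / \<epsilon>)) + A * (l / \<epsilon>) + (C * (real n * ln (1 / \<epsilon>)) + C * (l / \<epsilon>))"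
    unfolding const by (simp only: distrib_left distrib_right add_ac)
  ultimately show ?thesis unfolding grad_evals_eq by linarith
qed

section \<open>Coordinate spaces\<close>

lemma coord_sum: "coord (\<Sum>a\<in>A. h a) i = (\<Sum>a\<in>A. coord (h a) i)"
  by (induction A rule: infinite_finite_induct) auto

definition unit_seq :: "nat \<Rightarrow> fin_seq" where
  "unit_seq i = Fin_Seq (\<lambda>j. if j = i then 1 else 0)"

lemma coord_unit_seq: "coord (unit_seq i) j = (if j = i then 1 else 0)"
  unfolding unit_seq_def by (subst Fin_Seq_inverse) auto

lemma finite_frame_Rn: "finite_frame (Rn d) (unit_seq ` {..<d})"
proof
  show "subspace (Rn d)" by (rule subspace_Rn)
  show "finite (unit_seq ` {..<d})" by simp
  show "unit_seq ` {..<d} \<subseteq> Rn d" by (auto simp: Rn_def coord_unit_seq)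
  fix x assume x: "x \<in> Rn d"
  have inj: "inj_on unit_seq {..<d}"
    by (rule inj_onI) (metis coord_unit_seq zero_neq_one)
  have "inner x (unit_seq i) = coord x i" if "i < d" for i
    using that by (simp add: inner_Rn[OF x] coord_unit_seq if_distrib cong: if_cong)
  then have "(\<Sum>b\<in>unit_seq ` {..<d}. inner x b *\<^sub>R b) = (\<Sum>i<d. coord x i *\<^sub>R unit_seq i)"
    unfolding sum.reindex[OF inj] by (intro sum.cong) auto
  also have "\<dots> = x"
  proof (rule fin_seq_eqI)
    fix j
    have "coord (\<Sum>i<d. coord x i *\<^sub>R unit_seq i) j = (\<Sum>i<d. if j = i then coord x i else 0)"
      unfolding coord_sum by (intro sum.cong) (auto simp: coord_unit_seq)
    also have "\<dots> = coord x j" using x by (auto simp: Rn_def)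
    finally show "coord (\<Sum>i<d. coord x i *\<^sub>R unit_seq i) j = coord x j" .
  qed
  finally show "x = (\<Sum>b\<in>unit_seq ` {..<d}. inner x b *\<^sub>R b)" by simp
qed

lemma finite_sum_problem_Rn:
  "problem (Rn d) n f L R \<mu> xs \<Longrightarrow> finite_sum_problem (Rn d) (unit_seq ` {..<d}) n f L R \<mu> xs"
  by (intro finite_sum_problem.intro finite_sum_problem_axioms.intro finite_frame_Rn)

theorem corollary5p3:
  shows "(\<forall>d n (f :: nat \<Rightarrow> fin_seq \<Rightarrow> real) L R \<mu> xs x0 m1 S.
            problem (Rn d) n f L R \<mu> xs \<and> x0 \<in> Rn d \<and> m1 \<ge> 1 \<and> S \<ge> 1 \<longrightarrow>
            expected_gap (Rn d) n f L R (4 * avg_L n L) m1 0 x0 xs S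
              \<le> 1 / 2 ^ S * initial_bound n f L R m1 x0 xs)
       \<and>
       (\<forall>c D :: real. \<exists>C :: real.
          \<forall>d n (f :: nat \<Rightarrow> fin_seq \<Rightarrow> real) L R \<mu> xs x0 m1.
            problem (Rn d) n f L R \<mu> xs \<and> x0 \<in> Rn d \<and> m1 \<ge> 1 \<and>
            real m1 \<le> c * avg_L n L \<and> D = initial_bound n f L R m1 x0 xs \<longrightarrow>
            (\<forall>\<epsilon>. 0 < \<epsilon> \<and> \<epsilon> \<le> 1 / 2 \<longrightarrow>
              (\<exists>S\<ge>1.
                expected_gap (Rn d) n f L R (4 * avg_L n L) m1 0 x0 xs S \<le> \<epsilon> \<and>
                real (grad_evals n m1 S) \<le> C * (real n * ln (1 / \<epsilon>) + avg_L n L / \<epsilon>))))"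
proof (intro conjI allI impI; (elim conjE)?)
  fix d n L R \<mu> xs x0 and m1 S :: nat and f :: "nat \<Rightarrow> fin_seq \<Rightarrow> real"
  assume "problem (Rn d) n f L R \<mu> xs" and "x0 \<in> Rn d" "m1 \<ge> 1"
  then show "expected_gap (Rn d) n f L R (4 * avg_L n L) m1 0 x0 xs S
      \<le> 1 / 2 ^ S * initial_bound n f L R m1 x0 xs"
    using finite_sum_problem.expected_gap_le[OF finite_sum_problem_Rn] by simp
next
  fix c D :: real
  show "\<exists>C :: real. \<forall>d n (f :: nat \<Rightarrow> fin_seq \<Rightarrow> real) L R \<mu> xs x0 m1.
      problem (Rn d) n f L R \<mu> xs \<and> x0 \<in> Rn d \<and> m1 \<ge> 1 \<and>
      real m1 \<le> c * avg_L n L \<and> D = initial_bound n f L R m1 x0 xs \<longrightarrow>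
      (\<forall>\<epsilon>. 0 < \<epsilon> \<and> \<epsilon> \<le> 1 / 2 \<longrightarrow>
        (\<exists>S\<ge>1.
          expected_gap (Rn d) n f L R (4 * avg_L n L) m1 0 x0 xs S \<le> \<epsilon> \<and>
          real (grad_evals n m1 S) \<le> C * (real n * ln (1 / \<epsilon>) + avg_L n L / \<epsilon>)))"
  proof (intro exI[of _ "complexity_constant c D"] allI impI; elim conjE)
    fix d n L R \<mu> xs x0 and m1 :: nat and \<epsilon> :: real and f :: "nat \<Rightarrow> fin_seq \<Rightarrow> real"
    assume prob: "problem (Rn d) n f L R \<mu> xs" and x0: "x0 \<in> Rn d" and m1: "m1 \<ge> 1"
      and m1_le: "real m1 \<le> c * avg_L n L" and D: "D = initial_bound n f L R m1 x0 xs"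
      and \<epsilon>: "0 < \<epsilon>" "\<epsilon> \<le> 1 / 2"
    interpret finite_sum_problem "Rn d" "unit_seq ` {..<d}" n f L R \<mu> xs
      using prob by (rule finite_sum_problem_Rn)
    have "D \<ge> 0" unfolding D using x0 by (rule initial_bound_nonneg)
    have "c \<ge> 0"
    proof (rule ccontr)
      assume "\<not> c \<ge> 0"
      then have "c * avg_L n L < 0" using Lb_pos by (simp add: mult_neg_pos)
      then show False using m1_le by simp
    qed
    obtain S where S: "S \<ge> 1" "D / 2 ^ S \<le> \<epsilon>" "2 ^ S \<le> (1 + 2 * D) / \<epsilon>"
      using few_stages_suffice[OF \<open>D \<ge> 0\<close> \<epsilon>] by blast
    have "expected_gap (Rn d) n f L R (4 * avg_L n L) m1 0 x0 xs S \<le> \<epsilon>"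
      using expected_gap_le[OF x0 m1, of S] S(2) unfolding D by linarith
    moreover have "real (grad_evals n m1 S)
        \<le> complexity_constant c D * (real n * ln (1 / \<epsilon>) + avg_L n L / \<epsilon>)"
      using \<open>D \<ge> 0\<close> \<epsilon> S(3) m1_le Lb_pos \<open>c \<ge> 0\<close> by (rule grad_evals_le)
    ultimately show "\<exists>S\<ge>1. expected_gap (Rn d) n f L R (4 * avg_L n L) m1 0 x0 xs S \<le> \<epsilon> \<and>
        real (grad_evals n m1 S) \<le> complexity_constant c D * (real n * ln (1 / \<epsilon>) + avg_L n L / \<epsilon>)"
      using S(1) by blast
  qed
qed

end
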